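(* Let $n\geq 10$ and let $(G,\{\rho_0,\rho_1,\rho_2\})$ be a string C-group of rank $3$ with $|G|=2^n$. Define the finitely presented groups (each generated by $\rho_0,\rho_1,\rho_2$): $G_1=\langle \rho_0,\rho_1,\rho_2 \mid \rho_0^2, \rho_1^2, \rho_2^2, (\rho_0\rho_1)^{4}, (\rho_1\rho_2)^{2^{n-3}}, (\rho_0\rho_2)^2, [(\rho_0\rho_1)^2,\rho_2] \rangle$, $G_2=\langle \rho_0,\rho_1,\rho_2 \mid \rho_0^2, \rho_1^2, \rho_2^2, (\rho_0\rho_1)^{4}, (\rho_1\rho_2)^{2^{n-3}}, (\rho_0\rho_2)^2, [(\rho_0\rho_1)^2,\rho_2](\rho_1\rho_2)^{2^{n-4}} \rangle$, $G_3=\langle \rho_0,\rho_1,\rho_2 \mid \rho_0^2, \rho_1^2, \rho_2^2, (\rho_0\rho_1)^{4}, (\rho_1\rho_2)^{2^{n-4}}, (\rho_0\rho_2)^2, [(\rho_0\rho_1)^2, (\rho_1\rho_2)^2]\rangle$, $G_4=\langle \rho_0,\rho_1,\rho_2 \mid \rho_0^2, \rho_1^2, \rho_2^2, (\rho_0\rho_1)^{4}, (\rho_1\rho_2)^{2^{n-4}}, (\rho_0\rho_2)^2, [(\rho_0\rho_1)^2, (\rho_1\rho_2)^2](\rho_1\rho_2)^{2^{n-5}} \rangle$, $G_5=\langle \rho_0,\rho_1,\rho_2 \mid \rho_0^2, \rho_1^2, \rho_2^2, (\rho_0\rho_1)^{4}, (\rho_1\rho_2)^{2^{n-5}}, (\rho_0\rho_2)^2,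 [\rho_0, (\rho_1\rho_2)^2]^2, [\rho_0, (\rho_1\rho_2)^4]\rangle$, $G_6=\langle \rho_0,\rho_1,\rho_2 \mid \rho_0^2, \rho_1^2, \rho_2^2, (\rho_0\rho_1)^{4}, (\rho_1\rho_2)^{2^{n-5}}, (\rho_0\rho_2)^2, [\rho_0, (\rho_1\rho_2)^2]^2 (\rho_1\rho_2)^{2^{n-6}}, [\rho_0, (\rho_1\rho_2)^4]\rangle$, $G_7=\langle \rho_0,\rho_1,\rho_2 \mid \rho_0^2, \rho_1^2, \rho_2^2, (\rho_0\rho_1)^{4}, (\rho_1\rho_2)^{2^{n-5}}, (\rho_0\rho_2)^2, [\rho_0, (\rho_1\rho_2)^2]^2, [\rho_0, (\rho_1\rho_2)^4](\rho_1\rho_2)^{2^{n-6}}\rangle$, $G_8=\langle \rho_0,\rho_1,\rho_2 \mid \rho_0^2, \rho_1^2, \rho_2^2, (\rho_0\rho_1)^{4}, (\rho_1\rho_2)^{2^{n-5}}, (\rho_0\rho_2)^2, [\rho_0, (\rho_1\rho_2)^2]^2(\rho_1\rho_2)^{2^{n-6}}, [\rho_0, (\rho_1\rho_2)^4](\rho_1\rho_2)^{2^{n-6}}\rangle$. Then: (1) $(G,\{\rho_0,\rho_1,\rho_2\})$ has type $\{4,2^{n-3}\}$ if and only if $G \cong G_1$ or $G\cong G_2$; (2) it has type $\{4,2^{n-4}\}$ if and only if $G \cong G_3$ or $G\cong G_4$; (3) it has type $\{4,2^{n-5}\}$ if and only if $G \cong G_5$, $G_6$, $G_7$ or $G_8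$.
   Context: A string C-group of rank $3$ is a pair $(G,\{\rho_0,\rho_1,\rho_2\})$ where $G$ is a group generated by the three involutions $\rho_0,\rho_1,\rho_2$ such that $\rho_0\rho_2=\rho_2\rho_0$ and, writing $G_I=\langle \rho_i : i\in I\rangle$ for $I\subseteq\{0,1,2\}$, $G_I\cap G_J=G_{I\cap J}$ for all $I,J\subseteq\{0,1,2\}$. Its (Schläfli) type is $\{p_1,p_2\}$ where $p_1$ is the order of $\rho_0\rho_1$ and $p_2$ the order of $\rho_1\rho_2$. The commutator is $[x,y]=x^{-1}y^{-1}xy$. Isomorphism $G\cong G_i$ is understood via the generators $\rho_0,\rho_1,\rho_2$ of $G$ corresponding to the generators of the presentation of $G_i$. *)

theory Defs
  imports "HOL-Algebra.Generated_Groups" "HOL-Algebra.Multiplicative_Group"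
begin

text \<open>
  The letter \<open>(x, True)\<close> stands for the generator \<open>x\<close> and \<open>(x, False)\<close> for its formal inverse.
  The free group on \<open>S\<close> has the reduced words over \<open>S\<close> as elements; the product is
  concatenation followed by free reduction.
\<close>

definition flip_letter :: "'x \<times> bool \<Rightarrow> 'x \<times> bool" where
  "flip_letter l = (fst l, \<not> snd l)"

definition reduced_word :: "('x \<times> bool) list \<Rightarrow> bool" where
  "reduced_word w \<longleftrightarrow> successively (\<lambda>a b. b \<noteq> flip_letter a) w"

fun cancel_Cons :: "'x \<times> bool \<Rightarrow> ('x \<times> bool) list \<Rightarrow> ('x \<times> bool) list" where
  "cancel_Cons a [] = [a]"
| "cancel_Cons a (b # w) = (if b = flip_letter a then w else a # b # w)"

definition free_reduce :: "('x \<times> bool) list \<Rightarrow> ('x \<times> bool) list" where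
  "free_reduce w = foldr cancel_Cons w []"

definition free_group :: "'x set \<Rightarrow> ('x \<times> bool) list monoid" where
  "free_group S =
     \<lparr>carrier = {w \<in> lists (S \<times> UNIV). reduced_word w},
      mult = (\<lambda>u v. free_reduce (u @ v)),
      one = []\<rparr>"

definition free_gen :: "'x \<Rightarrow> ('x \<times> bool) list" where
  "free_gen x = [(x, True)]"

definition normal_closure :: "('a, 'b) monoid_scheme \<Rightarrow> 'a set \<Rightarrow> 'a set" where
  "normal_closure G R =
     generate G {g \<otimes>\<^bsub>G\<^esub> r \<otimes>\<^bsub>G\<^esub> inv\<^bsub>G\<^esub> g | g r. g \<in> carrier G \<and> r \<in> R}"

text \<open>The relators \<open>R\<close> of a presentation on \<open>S\<close> are elements of the free group on \<open>S\<close>.\<close>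

definition presented_group ::
    "'x set \<Rightarrow> ('x \<times> bool) list set \<Rightarrow> ('x \<times> bool) list set monoid" where
  "presented_group S R = free_group S Mod normal_closure (free_group S) R"

definition presented_gen ::
    "'x set \<Rightarrow> ('x \<times> bool) list set \<Rightarrow> 'x \<Rightarrow> ('x \<times> bool) list set" where
  "presented_gen S R x = normal_closure (free_group S) R #>\<^bsub>free_group S\<^esub> free_gen x"

definition iso_presentation ::
    "('a, 'b) monoid_scheme \<Rightarrow> ('x \<Rightarrow> 'a) \<Rightarrow> 'x set \<Rightarrow> ('x \<times> bool) list set \<Rightarrow> bool" where
  "iso_presentation G \<rho> S R \<longleftrightarrow>
     (\<exists>\<phi> \<in> iso G (presented_group S R). \<forall>x\<in>S. \<phi> (\<rho> x) = presented_gen S R x)"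

lemma flip_letter_simps [simp]:
  "flip_letter (flip_letter a) = a" "flip_letter a \<noteq> a" "a \<noteq> flip_letter a"
  "flip_letter a \<in> S \<times> UNIV \<longleftrightarrow> a \<in> S \<times> UNIV"
  by (auto simp: flip_letter_def prod_eq_iff mem_Times_iff)

lemma reduced_word_simps [simp]:
  "reduced_word []"
  "reduced_word (a # w) \<longleftrightarrow> w = [] \<or> hd w \<noteq> flip_letter a \<and> reduced_word w"
  by (auto simp: reduced_word_def successively_Cons)

lemma reduced_cancel_Cons: "reduced_word w \<Longrightarrow> reduced_word (cancel_Cons a w)"
  by (cases w) auto

lemma cancel_Cons_flip:
  assumes "reduced_word w"
  shows "cancel_Cons (flip_letter a) (cancel_Cons a w) = w"
proof (cases w)
  case (Cons b v)
  then show ?thesis using assms by (cases v) auto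
qed simp

lemma reduced_foldr: "reduced_word w \<Longrightarrow> reduced_word (foldr cancel_Cons u w)"
  by (induction u) (auto intro: reduced_cancel_Cons)

lemma free_reduce_reduced: "reduced_word w \<Longrightarrow> free_reduce w = w"
proof (induction w)
  case (Cons a w)
  then show ?case by (cases w) (auto simp: free_reduce_def)
qed (simp add: free_reduce_def)

lemma foldr_cancel_Cons:
  "reduced_word w \<Longrightarrow> reduced_word v \<Longrightarrow>
   foldr cancel_Cons (cancel_Cons a v) w = cancel_Cons a (foldr cancel_Cons v w)"
proof (cases v)
  case (Cons b u)
  assume "reduced_word w" "reduced_word v"
  then show ?thesis
    using Cons cancel_Cons_flip[of "foldr cancel_Cons u w" "flip_letter a"]
    by (auto simp: reduced_foldr)
qed simp

lemma foldr_free_reduce: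
  "reduced_word w \<Longrightarrow> foldr cancel_Cons (free_reduce u) w = foldr cancel_Cons u w"
proof (induction u)
  case (Cons a u)
  have "reduced_word (free_reduce u)"
    by (simp add: free_reduce_def reduced_foldr)
  then show ?case
    using Cons by (simp add: free_reduce_def foldr_cancel_Cons)
qed (simp add: free_reduce_def)

lemma cancel_Cons_lists: "a \<in> A \<Longrightarrow> w \<in> lists A \<Longrightarrow> cancel_Cons a w \<in> lists A"
  by (cases w) auto

lemma foldr_cancel_Cons_lists:
  "u \<in> lists A \<Longrightarrow> w \<in> lists A \<Longrightarrow> foldr cancel_Cons u w \<in> lists A"
  by (induction u) (simp_all add: cancel_Cons_lists del: in_lists_conv_set)

lemma free_reduce_append:
  "reduced_word v \<Longrightarrow> free_reduce (u @ v) = foldr cancel_Cons u v"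
  using free_reduce_reduced[of v] by (simp add: free_reduce_def)

lemma free_inverse:
  "free_reduce (rev (map flip_letter w) @ w) = []"
proof (induction w)
  case (Cons a w)
  have "reduced_word (foldr cancel_Cons w [])" by (simp add: reduced_foldr)
  then show ?case using Cons by (simp add: free_reduce_def cancel_Cons_flip)
qed (simp add: free_reduce_def)

lemma group_free_group: "group (free_group S)"
proof (rule groupI)
  fix u v assume "u \<in> carrier (free_group S)" "v \<in> carrier (free_group S)"
  then show "u \<otimes>\<^bsub>free_group S\<^esub> v \<in> carrier (free_group S)"
    by (simp add: free_group_def free_reduce_append reduced_foldr foldr_cancel_Cons_lists
        del: in_lists_conv_set)
next
  show "\<one>\<^bsub>free_group S\<^esub> \<in> carrier (free_group S)"
    by (simp add: free_group_def)
next
  fix u v w assume "u \<in> carrier (free_group S)" "v \<in> carrier (free_group S)"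
    "w \<in> carrier (free_group S)"
  then have red: "reduced_word v" "reduced_word w"
    by (simp_all add: free_group_def)
  have "free_reduce (free_reduce (u @ v) @ w) = foldr cancel_Cons (u @ v) w"
    using red(2) by (simp only: free_reduce_append foldr_free_reduce)
  moreover have "free_reduce (u @ free_reduce (v @ w)) = foldr cancel_Cons (u @ v) w"
    using red(2) by (simp add: free_reduce_append reduced_foldr)
  ultimately show "u \<otimes>\<^bsub>free_group S\<^esub> v \<otimes>\<^bsub>free_group S\<^esub> w =
      u \<otimes>\<^bsub>free_group S\<^esub> (v \<otimes>\<^bsub>free_group S\<^esub> w)"
    by (simp add: free_group_def)
next
  fix u assume "u \<in> carrier (free_group S)"
  then show "\<one>\<^bsub>free_group S\<^esub> \<otimes>\<^bsub>free_group S\<^esub> u = u"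
    by (simp add: free_group_def free_reduce_reduced)
next
  fix u assume u: "u \<in> carrier (free_group S)"
  have red: "reduced_word (rev (map flip_letter u))"
  proof -
    have "successively (\<lambda>a b. b \<noteq> flip_letter a) u"
      using u by (simp add: free_group_def reduced_word_def)
    then show ?thesis
      unfolding reduced_word_def successively_rev successively_map
      by (rule successively_mono) (metis flip_letter_simps(1))
  qed
  moreover have "rev (map flip_letter u) \<in> lists (S \<times> UNIV)"
    using u by (simp add: free_group_def lists_eq_set subset_iff mem_Times_iff flip_letter_def image_iff)
      (force simp: flip_letter_def)
  ultimately show "\<exists>v\<in>carrier (free_group S). v \<otimes>\<^bsub>free_group S\<^esub> u = \<one>\<^bsub>free_group S\<^esub>"
    using free_inverse[of u] by (auto simp: free_group_def)
qed

lemma (in group) normal_closure_normal: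
  assumes "R \<subseteq> carrier G"
  shows "normal_closure G R \<lhd> G"
  unfolding normal_closure_def
proof (rule normal_generateI)
  show "{g \<otimes> r \<otimes> inv g | g r. g \<in> carrier G \<and> r \<in> R} \<subseteq> carrier G"
    using assms by auto
next
  fix h g assume "h \<in> {g \<otimes> r \<otimes> inv g | g r. g \<in> carrier G \<and> r \<in> R}" and g: "g \<in> carrier G"
  then obtain k r where kr: "h = k \<otimes> r \<otimes> inv k" "k \<in> carrier G" "r \<in> R" by auto
  then have "g \<otimes> h \<otimes> inv g = (g \<otimes> k) \<otimes> r \<otimes> inv (g \<otimes> k)"
    using assms g by (simp add: inv_mult_group m_assoc subset_iff)
  then show "g \<otimes> h \<otimes> inv g \<in> {g \<otimes> r \<otimes> inv g | g r. g \<in> carrier G \<and> r \<in> R}"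
    using kr g by blast
qed

lemma group_presented_group:
  assumes "R \<subseteq> carrier (free_group S)"
  shows "group (presented_group S R)"
  unfolding presented_group_def
  by (intro normal.factorgroup_is_group group.normal_closure_normal group_free_group assms)

definition string_C_group3 :: "('a, 'b) monoid_scheme \<Rightarrow> (nat \<Rightarrow> 'a) \<Rightarrow> bool" where
  "string_C_group3 G \<rho> \<longleftrightarrow>
     group G \<and>
     (\<forall>i\<in>{0,1,2}. \<rho> i \<in> carrier G \<and> group.ord G (\<rho> i) = 2) \<and>
     generate G (\<rho> ` {0,1,2}) = carrier G \<and>
     \<rho> 0 \<otimes>\<^bsub>G\<^esub> \<rho> 2 = \<rho> 2 \<otimes>\<^bsub>G\<^esub> \<rho> 0 \<and>
     (\<forall>I J. I \<subseteq> {0,1,2} \<longrightarrow> J \<subseteq> {0,1,2} \<longrightarrow>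
        generate G (\<rho> ` I) \<inter> generate G (\<rho> ` J) = generate G (\<rho> ` (I \<inter> J)))"

definition schlafli_type :: "('a, 'b) monoid_scheme \<Rightarrow> (nat \<Rightarrow> 'a) \<Rightarrow> nat \<times> nat" where
  "schlafli_type G \<rho> =
     (group.ord G (\<rho> 0 \<otimes>\<^bsub>G\<^esub> \<rho> 1), group.ord G (\<rho> 1 \<otimes>\<^bsub>G\<^esub> \<rho> 2))"

text \<open>HOL-Algebra's derived subgroup uses the other convention \<open>x y x\<inverse> y\<inverse>\<close>.\<close>

definition commutator :: "('a, 'b) monoid_scheme \<Rightarrow> 'a \<Rightarrow> 'a \<Rightarrow> 'a" where
  "commutator G x y = inv\<^bsub>G\<^esub> x \<otimes>\<^bsub>G\<^esub> inv\<^bsub>G\<^esub> y \<otimes>\<^bsub>G\<^esub> x \<otimes>\<^bsub>G\<^esub> y"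

context
  fixes F :: "('a, 'b) monoid_scheme" (structure) and \<rho> :: "nat \<Rightarrow> 'a"
begin

definition relators_base :: "nat \<Rightarrow> 'a set" where
  "relators_base q =
     {\<rho> 0 [^] (2::nat), \<rho> 1 [^] (2::nat), \<rho> 2 [^] (2::nat),
      (\<rho> 0 \<otimes> \<rho> 1) [^] (4::nat), (\<rho> 1 \<otimes> \<rho> 2) [^] q, (\<rho> 0 \<otimes> \<rho> 2) [^] (2::nat)}"

definition relators1 :: "nat \<Rightarrow> 'a set" where
  "relators1 n = relators_base (2 ^ (n - 3)) \<union>
     {commutator F ((\<rho> 0 \<otimes> \<rho> 1) [^] (2::nat)) (\<rho> 2)}"

definition relators2 :: "nat \<Rightarrow> 'a set" where
  "relators2 n = relators_base (2 ^ (n - 3)) \<union>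
     {commutator F ((\<rho> 0 \<otimes> \<rho> 1) [^] (2::nat)) (\<rho> 2)
        \<otimes> (\<rho> 1 \<otimes> \<rho> 2) [^] (2 ^ (n - 4) :: nat)}"

definition relators3 :: "nat \<Rightarrow> 'a set" where
  "relators3 n = relators_base (2 ^ (n - 4)) \<union>
     {commutator F ((\<rho> 0 \<otimes> \<rho> 1) [^] (2::nat)) ((\<rho> 1 \<otimes> \<rho> 2) [^] (2::nat))}"

definition relators4 :: "nat \<Rightarrow> 'a set" where
  "relators4 n = relators_base (2 ^ (n - 4)) \<union>
     {commutator F ((\<rho> 0 \<otimes> \<rho> 1) [^] (2::nat)) ((\<rho> 1 \<otimes> \<rho> 2) [^] (2::nat))
        \<otimes> (\<rho> 1 \<otimes> \<rho> 2) [^] (2 ^ (n - 5) :: nat)}"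

definition relators5 :: "nat \<Rightarrow> 'a set" where
  "relators5 n = relators_base (2 ^ (n - 5)) \<union>
     {commutator F (\<rho> 0) ((\<rho> 1 \<otimes> \<rho> 2) [^] (2::nat)) [^] (2::nat),
      commutator F (\<rho> 0) ((\<rho> 1 \<otimes> \<rho> 2) [^] (4::nat))}"

definition relators6 :: "nat \<Rightarrow> 'a set" where
  "relators6 n = relators_base (2 ^ (n - 5)) \<union>
     {commutator F (\<rho> 0) ((\<rho> 1 \<otimes> \<rho> 2) [^] (2::nat)) [^] (2::nat)
        \<otimes> (\<rho> 1 \<otimes> \<rho> 2) [^] (2 ^ (n - 6) :: nat),
      commutator F (\<rho> 0) ((\<rho> 1 \<otimes> \<rho> 2) [^] (4::nat))}"

definition relators7 :: "nat \<Rightarrow> 'a set" where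
  "relators7 n = relators_base (2 ^ (n - 5)) \<union>
     {commutator F (\<rho> 0) ((\<rho> 1 \<otimes> \<rho> 2) [^] (2::nat)) [^] (2::nat),
      commutator F (\<rho> 0) ((\<rho> 1 \<otimes> \<rho> 2) [^] (4::nat))
        \<otimes> (\<rho> 1 \<otimes> \<rho> 2) [^] (2 ^ (n - 6) :: nat)}"

definition relators8 :: "nat \<Rightarrow> 'a set" where
  "relators8 n = relators_base (2 ^ (n - 5)) \<union>
     {commutator F (\<rho> 0) ((\<rho> 1 \<otimes> \<rho> 2) [^] (2::nat)) [^] (2::nat)
        \<otimes> (\<rho> 1 \<otimes> \<rho> 2) [^] (2 ^ (n - 6) :: nat),
      commutator F (\<rho> 0) ((\<rho> 1 \<otimes> \<rho> 2) [^] (4::nat))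
        \<otimes> (\<rho> 1 \<otimes> \<rho> 2) [^] (2 ^ (n - 6) :: nat)}"

end

abbreviation F3 :: "(nat \<times> bool) list monoid" where
  "F3 \<equiv> free_group {0, 1, 2}"

end

theory Submission
  imports Defs "HOL-Algebra.Group_Action" "HOL-Algebra.Left_Coset"
    "HOL-Computational_Algebra.Primes"
begin

text \<open>
  Write \<open>a, b, c\<close> for the generators, \<open>r = b c\<close>, and \<open>D\<close> for the dihedral subgroup generated by
  \<open>b\<close> and \<open>c\<close>. In the three cases the index of \<open>D\<close> in \<open>G\<close> is 4, 8 and 16. Coset
  enumeration over \<open>D\<close> bounds the order of any group satisfying the relators by \<open>2 ^ n\<close>, so a
  group of order \<open>2 ^ n\<close> satisfying them is presented by them and has the right type.

  Conversely, the type forces the relators: \<open>\<langle>r\<rangle>\<close> acts on the cosets of \<open>D\<close> in orbits of 2-power size, and there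
  are subgroups \<open>G > M > N\<close> of successive index 2 that contain \<open>D\<close>, with \<open>z = (a b)\<^sup>2\<close> in \<open>M\<close> and
  \<open>w = a b c b a\<close> in \<open>N\<close>. Counting cosets in \<open>G\<close>, \<open>M\<close> and \<open>N\<close> therefore puts conjugates of small
  powers of \<open>r\<close> by \<open>a\<close>, \<open>z\<close> and \<open>w\<close> into \<open>D\<close>. Such a conjugate has order at least 4, so it is
  itself a power of \<open>r\<close>, and the exponent is determined up to half the order of \<open>r\<close> because \<open>z\<close>
  centralises and \<open>w\<close> inverts every power of \<open>r\<close> that \<open>a\<close> conjugates to a power of \<open>r\<close>.
\<close>

section \<open>Conjugation and triples of involutions\<close>

text \<open>The identity behind the computations is \<open>a r a = z r\<close>. It gives
  \<open>a r^2 a = (z r z) r\<close>, \<open>z = (a r a) r^(-1)\<close> and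
  \<open>w = (a r^2 a) c\<close>, so that the effect of \<open>z\<close> and \<open>w\<close> on
  powers of \<open>r\<close> controls the effect of \<open>a\<close>. The third case is the
  obstacle. Counting puts only \<open>a r^8 a\<close> and \<open>w r^2 w\<close> into
  \<open>D\<close>, whereas the relators speak of \<open>a r^4 a\<close>. If \<open>a r^4 a\<close>
  were outside \<open>D\<close>, then so would be \<open>z r^2 z\<close> and \<open>w r w\<close>,
  and these three failures produce more cosets of \<open>D\<close> in \<open>N\<close> than there
  are. Deriving them means comparing exponents of \<open>r\<close> modulo 32; with \<open>r\<close>
  of order \<open>2 ^ (n - 5)\<close>, this is where \<open>n \<ge> 10\<close> enters. In the other
  direction the order of \<open>G\<close> is given, so an upper bound for the presented group is all
  that the isomorphism takes: the canonical surjection onto \<open>G\<close> must then be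
  injective.\<close>

definition conj_by :: "('a, 'b) monoid_scheme \<Rightarrow> 'a \<Rightarrow> 'a \<Rightarrow> 'a" where
  "conj_by G g x = g \<otimes>\<^bsub>G\<^esub> x \<otimes>\<^bsub>G\<^esub> inv\<^bsub>G\<^esub> g"

context group
begin

lemma conj_by_closed [simp]: "g \<in> carrier G \<Longrightarrow> x \<in> carrier G \<Longrightarrow> conj_by G g x \<in> carrier G"
  by (simp add: conj_by_def)

lemma conj_by_mult:
  "g \<in> carrier G \<Longrightarrow> x \<in> carrier G \<Longrightarrow> y \<in> carrier G \<Longrightarrow>
   conj_by G g (x \<otimes> y) = conj_by G g x \<otimes> conj_by G g y"
  by (simp add: conj_by_def m_assoc inv_solve_left)

lemma conj_by_one [simp]: "g \<in> carrier G \<Longrightarrow> conj_by G g \<one> = \<one>"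
  by (simp add: conj_by_def)

lemma group_hom_conj_by: "g \<in> carrier G \<Longrightarrow> group_hom G G (conj_by G g)"
  by unfold_locales (auto simp: hom_def conj_by_mult)

lemma conj_by_inv:
  "g \<in> carrier G \<Longrightarrow> x \<in> carrier G \<Longrightarrow> conj_by G g (inv x) = inv (conj_by G g x)"
  using group_hom.hom_inv[OF group_hom_conj_by] by blast

lemma conj_by_int_pow:
  "g \<in> carrier G \<Longrightarrow> x \<in> carrier G \<Longrightarrow>
   conj_by G g (x [^] (k::int)) = conj_by G g x [^] k"
  using group_hom.hom_int_pow[OF group_hom_conj_by] by blast

lemma conj_by_conj_by:
  "g \<in> carrier G \<Longrightarrow> h \<in> carrier G \<Longrightarrow> x \<in> carrier G \<Longrightarrow>
   conj_by G (g \<otimes> h) x = conj_by G g (conj_by G h x)"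
  by (simp add: conj_by_def m_assoc inv_mult_group)

lemma conj_by_eq_iff:
  "g \<in> carrier G \<Longrightarrow> x \<in> carrier G \<Longrightarrow> y \<in> carrier G \<Longrightarrow>
   conj_by G g x = y \<longleftrightarrow> g \<otimes> x = y \<otimes> g"
  by (simp add: conj_by_def) (metis inv_solve_right m_closed)

lemma conj_by_twice:
  "g \<in> carrier G \<Longrightarrow> x \<in> carrier G \<Longrightarrow> g \<otimes> g = \<one> \<Longrightarrow> conj_by G g (conj_by G g x) = x"
  by (simp add: conj_by_eq_iff flip: conj_by_conj_by)

lemma inv_involution: "x \<in> carrier G \<Longrightarrow> x \<otimes> x = \<one> \<Longrightarrow> inv x = x"
  by (simp add: inv_equality)

end

locale involution_triple = group G for G (structure) +
  fixes a b c
  assumes a [simp]: "a \<in> carrier G" and b [simp]: "b \<in> carrier G" and c [simp]: "c \<in> carrier G"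
    and aa [simp]: "a \<otimes> a = \<one>" and bb [simp]: "b \<otimes> b = \<one>" and cc [simp]: "c \<otimes> c = \<one>"
    and ca: "c \<otimes> a = a \<otimes> c"
    and baba: "b \<otimes> (a \<otimes> (b \<otimes> a)) = a \<otimes> (b \<otimes> (a \<otimes> b))"
    and generated: "generate G {a, b, c} = carrier G"
begin

definition rot :: "int \<Rightarrow> 'a" where "rot k = (b \<otimes> c) [^] k"
text \<open>The rotations and the reflections of the dihedral group generated by \<open>b\<close> and \<open>c\<close>.\<close>

definition D :: "'a set" where "D = range rot \<union> (\<lambda>k. rot k \<otimes> c) ` UNIV"
definition z :: 'a where "z = a \<otimes> (b \<otimes> (a \<otimes> b))"
definition w :: 'a where "w = a \<otimes> (b \<otimes> (c \<otimes> (b \<otimes> a)))"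

abbreviation cj :: "'a \<Rightarrow> 'a \<Rightarrow> 'a" where "cj \<equiv> conj_by G"

lemma rot_closed [simp]: "rot k \<in> carrier G"
  by (simp add: rot_def)

lemma aa' [simp]: "x \<in> carrier G \<Longrightarrow> a \<otimes> (a \<otimes> x) = x"
  by (simp flip: m_assoc)
lemma bb' [simp]: "x \<in> carrier G \<Longrightarrow> b \<otimes> (b \<otimes> x) = x"
  by (simp flip: m_assoc)
lemma cc' [simp]: "x \<in> carrier G \<Longrightarrow> c \<otimes> (c \<otimes> x) = x"
  by (simp flip: m_assoc)
lemma ca': "x \<in> carrier G \<Longrightarrow> c \<otimes> (a \<otimes> x) = a \<otimes> (c \<otimes> x)"
  by (simp add: ca flip: m_assoc)
lemma baba': "x \<in> carrier G \<Longrightarrow> b \<otimes> (a \<otimes> (b \<otimes> (a \<otimes> x))) = a \<otimes> (b \<otimes> (a \<otimes> (b \<otimes> x)))"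
  using arg_cong[OF baba, of "\<lambda>y. y \<otimes> x"] by (simp add: m_assoc)

lemmas word_simps = m_assoc ca ca' baba baba'

lemma inv_a [simp]: "inv a = a" and inv_b [simp]: "inv b = b" and inv_c [simp]: "inv c = c"
  by (simp_all add: inv_involution)

lemma z_closed [simp]: "z \<in> carrier G" and w_closed [simp]: "w \<in> carrier G"
  by (simp_all add: z_def w_def)
lemma zz [simp]: "z \<otimes> z = \<one>"
  by (simp add: z_def word_simps)
lemma ww [simp]: "w \<otimes> w = \<one>"
  by (simp add: w_def word_simps)
lemma inv_z [simp]: "inv z = z" and inv_w [simp]: "inv w = w"
  by (simp_all add: inv_involution)

lemma rot_0 [simp]: "rot 0 = \<one>"
  by (simp add: rot_def)
lemma rot_1: "rot 1 = b \<otimes> c"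
  by (simp add: rot_def)
lemma rot_add: "rot i \<otimes> rot j = rot (i + j)"
  by (simp add: rot_def int_pow_mult)
lemma rot_add': "x \<in> carrier G \<Longrightarrow> rot i \<otimes> (rot j \<otimes> x) = rot (i + j) \<otimes> x"
  by (simp add: rot_add flip: m_assoc)
lemma inv_rot: "inv (rot i) = rot (- i)"
  by (simp add: rot_def int_pow_neg)
lemma rot_pow: "rot i [^] (k::int) = rot (i * k)"
  by (simp add: rot_def int_pow_pow)

lemma rot_2: "rot 2 = b \<otimes> (c \<otimes> (b \<otimes> c))"
  using rot_add[of 1 1] by (simp add: rot_1 m_assoc)

lemma cj_b_rot: "cj b (rot k) = rot (- k)" and cj_c_rot: "cj c (rot k) = rot (- k)"
proof -
  have "cj b (b \<otimes> c) = inv (b \<otimes> c)" "cj c (b \<otimes> c) = inv (b \<otimes> c)"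
    by (simp_all add: conj_by_def m_assoc inv_mult_group)
  then show "cj b (rot k) = rot (- k)" "cj c (rot k) = rot (- k)"
    by (simp_all add: rot_def conj_by_int_pow int_pow_inv int_pow_neg)
qed

lemma c_rot: "c \<otimes> rot k = rot (- k) \<otimes> c"
  using cj_c_rot[of k] by (simp add: conj_by_eq_iff)
lemma c_rot': "x \<in> carrier G \<Longrightarrow> c \<otimes> (rot k \<otimes> x) = rot (- k) \<otimes> (c \<otimes> x)"
  by (simp add: c_rot flip: m_assoc)
lemma b_eq: "b = rot 1 \<otimes> c"
  by (simp add: rot_1 m_assoc)

lemma rot_in_D [simp]: "rot k \<in> D" and rot_c_in_D: "rot k \<otimes> c \<in> D"
  by (auto simp: D_def)
lemma c_in_D [simp]: "c \<in> D"
  using rot_c_in_D[of 0] by simp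
lemma b_in_D [simp]: "b \<in> D"
  using rot_c_in_D[of 1] b_eq by simp

lemma subgroup_D: "subgroup D G"
proof (rule subgroupI)
  show "D \<subseteq> carrier G" "D \<noteq> {}" by (auto simp: D_def)
next
  fix x assume "x \<in> D"
  then show "inv x \<in> D" by (auto simp: D_def inv_mult_group inv_rot c_rot)
next
  fix x y assume "x \<in> D" "y \<in> D"
  then show "x \<otimes> y \<in> D"
    by (auto simp: D_def m_assoc rot_add rot_add' c_rot c_rot')
qed

lemma D_sub: "D \<subseteq> carrier G"
  using subgroup_D subgroup.subset by blast

lemma D_square:
  assumes "x \<in> D" "x \<otimes> x \<noteq> \<one>" shows "x \<in> range rot"
  using assms by (auto simp: D_def m_assoc rot_add rot_add' c_rot c_rot')

lemma cj_rot_mult: "g \<in> carrier G \<Longrightarrow> cj g (rot d) = rot e \<Longrightarrow> cj g (rot (d * k)) = rot (e * k)"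
  by (simp add: conj_by_int_pow flip: rot_pow)

lemma cj_rot_minus: "g \<in> carrier G \<Longrightarrow> cj g (rot d) = rot e \<Longrightarrow> cj g (rot (- d)) = rot (- e)"
  using cj_rot_mult[of g d e "-1"] by simp

lemma cj_rot_swap: "g \<in> carrier G \<Longrightarrow> g \<otimes> g = \<one> \<Longrightarrow> cj g (rot d) = rot e \<Longrightarrow> cj g (rot e) = rot d"
  by (metis conj_by_twice rot_closed)

text \<open>Reading \<open>z = a b a b\<close> from the right, the exponent runs through
  \<open>d\<close>, \<open>- d\<close>, \<open>- e\<close>, \<open>e\<close>, \<open>d\<close>:
  \<open>b\<close> negates it and \<open>a\<close> exchanges multiples of \<open>d\<close> and
  \<open>e\<close>.\<close>

lemma cj_z_fixes:
  assumes "cj a (rot d) = rot e" shows "cj z (rot d) = rot d"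
proof -
  have e: "cj a (rot e) = rot d"
    by (rule cj_rot_swap[OF a aa assms])
  show ?thesis
    by (simp add: z_def conj_by_conj_by cj_b_rot cj_rot_minus[OF a assms] e)
qed

text \<open>Between the two exchanges of \<open>d\<close> and \<open>e\<close> by \<open>a\<close>,
  the letters \<open>b\<close>, \<open>c\<close>, \<open>b\<close> negate the exponent three
  times.\<close>

lemma cj_w_inverts:
  assumes "cj a (rot d) = rot e" shows "cj w (rot d) = rot (- d)"
proof -
  have "cj a (rot (- e)) = rot (- d)"
    by (rule cj_rot_minus[OF a cj_rot_swap[OF a aa assms]])
  then show ?thesis
    by (simp add: w_def conj_by_conj_by cj_b_rot cj_c_rot assms)
qed

text \<open>Here \<open>a r a = a b a c = z r\<close>, and squaring gives
  \<open>z r z r\<close>.\<close>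

lemma cj_a_rot_2: "cj a (rot 2) = cj z (rot 1) \<otimes> rot 1"
  unfolding conj_by_def inv_z inv_a by (simp add: rot_1 rot_2 z_def word_simps)

lemma cj_z_rot_2: "cj z (rot 2) = cj z (rot 1) \<otimes> cj z (rot 1)"
  using rot_add[of 1 1] by (simp flip: conj_by_mult)

text \<open>Since \<open>z = (a r a) r^(-1)\<close>, conjugation by \<open>z\<close> agrees with
  conjugation by \<open>a r a\<close> on powers of \<open>r\<close>; moreover
  \<open>r (a r^2 a) r^(-1) = r (z r z)\<close>.\<close>

lemma cj_z_rot_2': "cj z (rot 2) = cj a (rot 1 \<otimes> cj z (rot 1))"
  unfolding conj_by_def inv_z inv_a by (simp add: rot_1 rot_2 z_def word_simps)

lemma w_eq: "w = cj a (rot 2) \<otimes> c"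
  by (simp add: w_def conj_by_def rot_2 word_simps)

lemma cj_w_rot: "cj w (rot k) = cj (cj a (rot 2)) (rot (- k))"
  by (simp add: w_eq conj_by_conj_by cj_c_rot)

text \<open>With \<open>y = z r z\<close>, conjugation by \<open>a\<close> sends \<open>r^2\<close>
  to \<open>y r\<close> and \<open>r^x\<close> to \<open>r y\<close>, hence \<open>r^(2 + x)\<close>
  to \<open>y r^2 y\<close>. As \<open>z\<close> is an involution, \<open>r^2 = z r^x z\<close> is a
  power of \<open>y\<close> and commutes with it, and \<open>y^2 = r^x\<close>.\<close>

lemma cj_a_fixes:
  assumes "cj z (rot 2) = rot x" shows "cj a (rot (2 + x)) = rot (2 + x)"
proof -
  define y where "y = cj z (rot 1)"
  have [simp]: "y \<in> carrier G" by (simp add: y_def)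
  have "cj z (rot x) = rot 2"
    by (rule cj_rot_swap[OF z_closed zz assms])
  then have R: "rot 2 = y [^] x"
    unfolding y_def by (metis conj_by_int_pow mult_1 rot_closed rot_pow z_closed)
  have "y \<otimes> rot 2 = rot 2 \<otimes> y"
    unfolding R using int_pow_mult[of y 1 x] int_pow_mult[of y x 1]
    by (simp only: int_pow_1 \<open>y \<in> carrier G\<close> add.commute[of x])
  then have yR: "y \<otimes> (rot 2 \<otimes> y) = rot 2 \<otimes> (y \<otimes> y)"
    by (metis \<open>y \<in> carrier G\<close> m_assoc rot_closed)
  have T: "cj a (rot x) = rot 1 \<otimes> y"
    unfolding assms[symmetric] cj_z_rot_2' y_def by (rule conj_by_twice) simp_all
  have "cj a (rot (2 + x)) = cj a (rot 2) \<otimes> cj a (rot x)"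
    unfolding rot_add[symmetric] by (rule conj_by_mult) simp_all
  also have "\<dots> = (y \<otimes> rot 1) \<otimes> (rot 1 \<otimes> y)"
    unfolding T cj_a_rot_2 y_def ..
  also have "\<dots> = y \<otimes> (rot 2 \<otimes> y)"
    by (simp add: m_assoc rot_add')
  also have "\<dots> = rot 2 \<otimes> cj z (rot 2)"
    using yR by (simp only: cj_z_rot_2 y_def)
  also have "\<dots> = rot (2 + x)"
    unfolding assms by (rule rot_add)
  finally show ?thesis .
qed

end

section \<open>Counting cosets\<close>

text \<open>The action is the identity on sets that leave the carrier, so that its laws hold without
  a side condition on \<open>p\<close> and can rewrite freely in the coset tables.\<close>

definition coset_act :: "('a, 'b) monoid_scheme \<Rightarrow> 'a \<Rightarrow> 'a set \<Rightarrow> 'a set" where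
  "coset_act G g p = (if p \<subseteq> carrier G then g <#\<^bsub>G\<^esub> p else p)"

context group
begin

lemma coset_act_mult:
  assumes "g \<in> carrier G" "h \<in> carrier G"
  shows "coset_act G (g \<otimes> h) p = coset_act G g (coset_act G h p)"
  using assms by (auto simp: coset_act_def lcos_m_assoc l_coset_subset_G)

lemma coset_act_one [simp]: "coset_act G \<one> p = p"
  by (simp add: coset_act_def lcos_mult_one)

lemma coset_act_inv [simp]:
  assumes "g \<in> carrier G"
  shows "coset_act G (inv g) (coset_act G g p) = p" "coset_act G g (coset_act G (inv g) p) = p"
  using assms by (simp_all flip: coset_act_mult)

lemma coset_act_subgroup:
  "subgroup H G \<Longrightarrow> coset_act G g H = g <# H"
  by (simp add: coset_act_def subgroup.subset)

lemma coset_act_self [simp]: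
  "subgroup H G \<Longrightarrow> h \<in> H \<Longrightarrow> coset_act G h H = H"
  by (simp add: coset_act_subgroup coset_join3 subgroup.mem_carrier)

lemma coset_act_eq_self_iff:
  assumes "subgroup H G" "g \<in> carrier G"
  shows "coset_act G g H = H \<longleftrightarrow> g \<in> H"
  using assms by (metis coset_act_self coset_act_subgroup lcos_self)

lemma coset_act_fixes_iff:
  assumes "subgroup H G" "g \<in> carrier G" "x \<in> carrier G"
  shows "coset_act G g (coset_act G x H) = coset_act G x H \<longleftrightarrow> conj_by G (inv x) g \<in> H"
proof -
  have "coset_act G g (coset_act G x H) = coset_act G x H \<longleftrightarrow>
        coset_act G (inv x) (coset_act G g (coset_act G x H)) = H"
    using assms by (metis coset_act_inv)
  also have "\<dots> \<longleftrightarrow> coset_act G (conj_by G (inv x) g) H = H"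
    using assms by (simp add: conj_by_def coset_act_mult)
  finally show ?thesis
    using assms by (simp add: coset_act_eq_self_iff)
qed

lemma card_coset_act:
  assumes "subgroup H G" "g \<in> carrier G"
  shows "card (coset_act G g H) = card H"
proof -
  have "inj_on (\<lambda>h. g \<otimes> h) H"
    using assms by (auto intro!: inj_onI simp: subgroup.mem_carrier)
  moreover have "coset_act G g H = (\<lambda>h. g \<otimes> h) ` H"
    using assms by (auto simp: coset_act_subgroup l_coset_def)
  ultimately show ?thesis by (simp add: card_image)
qed

lemma coset_act_disjoint:
  assumes "subgroup H G" "g \<in> carrier G" "h \<in> carrier G" "coset_act G g H \<noteq> coset_act G h H"
  shows "coset_act G g H \<inter> coset_act G h H = {}"
  using assms by (metis coset_act_subgroup disjoint_iff l_repr_independence)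

lemma card_cosets_le:
  assumes H: "subgroup H G" and K: "subgroup K G" "finite K" "H \<subseteq> K"
    and P: "P \<subseteq> (\<lambda>g. coset_act G g H) ` K"
  shows "card P * card H \<le> card K"
proof -
  have KG: "K \<subseteq> carrier G" by (rule subgroup.subset[OF K(1)])
  have "finite P" using P K(2) finite_surj by blast
  moreover have "\<Union>P \<subseteq> K"
  proof -
    have "coset_act G g H \<subseteq> K" if "g \<in> K" for g
      using that H K by (auto simp: coset_act_subgroup l_coset_def intro: subgroup.m_closed)
    then show ?thesis using P by blast
  qed
  moreover have "card H * card P = card (\<Union>P)"
  proof (rule card_partition)
    show "finite (\<Union>P)" using \<open>\<Union>P \<subseteq> K\<close> K(2) finite_subset by blast
  next
    fix p assume "p \<in> P" then show "card p = card H" using P KG card_coset_act[OF H] by blast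
  next
    fix p q assume "p \<in> P" "q \<in> P" "p \<noteq> q"
    then show "p \<inter> q = {}" using P KG coset_act_disjoint[OF H] by blast
  qed (rule \<open>finite P\<close>)
  ultimately show ?thesis
    using card_mono[OF K(2)] by (metis mult.commute)
qed

text \<open>A family that contains \<open>H\<close> and is stable under the generators contains
  every left coset of \<open>H\<close>. Further members of \<open>P\<close> only weaken the bound,
  so a coset table can be used without showing that it is minimal.\<close>

lemma card_le_of_closed_cosets:
  assumes H: "subgroup H G" "finite H" and gen: "generate G S = carrier G" "S \<subseteq> carrier G"
    and S: "\<And>s. s \<in> S \<Longrightarrow> inv s \<in> S"
    and P: "finite P" "H \<in> P" "\<And>s p. s \<in> S \<Longrightarrow> p \<in> P \<Longrightarrow> coset_act G s p \<in> P"
  shows "finite (carrier G) \<and> card (carrier G) \<le> card P * card H"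
proof -
  have act: "coset_act G g p \<in> P" if "g \<in> generate G S" "p \<in> P" for g p
    using that
  proof (induction arbitrary: p)
    case (eng g h)
    then show ?case using gen by (simp add: coset_act_mult)
  qed (use P S in auto)
  let ?Q = "(\<lambda>g. coset_act G g H) ` carrier G"
  have Q: "?Q \<subseteq> P" using act gen P by auto
  then have "finite ?Q" using P finite_subset by blast
  have "g \<in> \<Union>?Q" if "g \<in> carrier G" for g
    using that H lcos_self by (auto simp: coset_act_subgroup)
  then have sub: "carrier G \<subseteq> \<Union>?Q" by blast
  have fin: "finite (coset_act G g H)" if "g \<in> carrier G" for g
    using H by (simp add: coset_act_subgroup l_coset_def)
  then have "finite (\<Union>?Q)" using \<open>finite ?Q\<close> by auto
  then have "card (carrier G) \<le> card (\<Union>?Q)" using sub card_mono by blast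
  also have "\<dots> \<le> (\<Sum>p\<in>?Q. card p)"
    by (rule card_Union_le_sum_card)
  also have "\<dots> = card ?Q * card H"
  proof -
    have "(\<Sum>p\<in>?Q. card p) = (\<Sum>p\<in>?Q. card H)"
      using card_coset_act[OF H(1)] by (intro sum.cong) auto
    then show ?thesis by simp
  qed
  also have "\<dots> \<le> card P * card H"
    using card_mono[OF P(1) Q] by simp
  finally show ?thesis using sub \<open>finite (\<Union>?Q)\<close> finite_subset by blast
qed

text \<open>The orbit of a coset under a 2-element has 2-power size, so it cannot have more than
  \<open>2 ^ j\<close> elements without having at least \<open>2 ^ (j + 1)\<close>, none of which is \<open>H\<close> itself.\<close>

lemma conj_pow_mem:
  assumes H: "subgroup H G" and K: "subgroup K G" "finite K" "H \<subseteq> K"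
    and card: "card K \<le> 2 ^ Suc j * card H"
    and r: "r \<in> H" "r [^] (2 ^ p :: int) = \<one>" and x: "x \<in> K"
  shows "conj_by G x (r [^] (2 ^ j :: int)) \<in> H"
proof (rule ccontr)
  assume not: "conj_by G x (r [^] (2 ^ j :: int)) \<notin> H"
  have G [simp]: "r \<in> carrier G" "x \<in> carrier G" 
    using r x H K by (auto simp: subgroup.mem_carrier)
  define pt where "pt m = coset_act G (r [^] (m::int)) (coset_act G (inv x) H)" for m
  have pt_eq: "pt i = pt j \<longleftrightarrow> conj_by G x (r [^] (j - i)) \<in> H" for i j
  proof -
    have "pt i = pt j \<longleftrightarrow> coset_act G (inv (r [^] i)) (pt j) = coset_act G (inv x) H"
      unfolding pt_def by (metis G coset_act_inv int_pow_closed)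
    also have "coset_act G (inv (r [^] i)) (pt j) = pt (j - i)"
      unfolding pt_def using int_pow_mult[of r "- i" j]
      by (simp add: int_pow_neg flip: coset_act_mult[of "inv (r [^] i)" "r [^] j"])
    finally show ?thesis unfolding pt_def using coset_act_fixes_iff[OF H] by simp
  qed
  \<comment> \<open>The exponents \<open>m\<close> for which the conjugate of \<open>r^m\<close>
    lies in \<open>H\<close> form a subgroup of the integers that contains \<open>2 ^ p\<close>, so
    it is generated by some \<open>2 ^ i\<close>; \<open>i \<le> j\<close> would contradict
    \<open>not\<close>.\<close>
  have dvd: "2 ^ Suc j dvd m" if "conj_by G x (r [^] (m::int)) \<in> H" for m
  proof (rule ccontr)
    assume ndvd: "\<not> 2 ^ Suc j dvd m"
    define g where "g = gcd m (2 ^ p)"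
    have "nat g dvd 2 ^ p"
      by (simp add: g_def nat_dvd_iff)
    then obtain i where "nat g = 2 ^ i"
      using divides_primepow_nat two_is_prime_nat by blast
    then have i: "g = 2 ^ i"
      by (metis g_def gcd_ge_0_int int_nat_eq of_nat_numeral of_nat_power)
    then have "i \<le> j" using ndvd by (metis dvd_trans g_def gcd_dvd1 le_imp_power_dvd not_less_eq_eq)
    obtain u v where uv: "u * m + v * 2 ^ p = g" using bezout_int g_def by metis
    have "conj_by G x (r [^] (m * u)) = conj_by G x (r [^] m) [^] u"
      by (simp add: conj_by_int_pow flip: int_pow_pow)
    then have "conj_by G x (r [^] (m * u)) \<in> H"
      using that H subgroup_int_pow_closed by simp
    moreover have "r [^] g = r [^] (m * u)"
      using r(2) uv int_pow_mult[of r "u * m" "v * 2 ^ p"] int_pow_pow[of r "2 ^ p" v]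
      by (simp add: mult.commute)
    ultimately have "conj_by G x (r [^] g) [^] (2 ^ (j - i) :: int) \<in> H"
      using H subgroup_int_pow_closed by simp
    then show False using not i \<open>i \<le> j\<close>
      by (simp add: conj_by_int_pow int_pow_pow flip: power_add)
  qed
  have inj: "inj_on pt {0..<2 ^ Suc j}"
  proof (rule inj_onI)
    fix m n :: int assume mn: "m \<in> {0..<2 ^ Suc j}" "n \<in> {0..<2 ^ Suc j}" "pt m = pt n"
    then have "2 ^ Suc j dvd n - m" using pt_eq dvd by blast
    then show "m = n" using mn zdvd_imp_le[of "2 ^ Suc j" "n - m"] zdvd_imp_le[of "2 ^ Suc j" "m - n"]
      by (cases m n rule: linorder_cases) (auto simp: dvd_diff_commute)
  qed
  have "x \<notin> H" using not r H by (auto simp: conj_by_def intro!: subgroup.m_closed subgroup.m_inv_closed subgroup_int_pow_closed)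
  have "H \<noteq> pt m" for m
  proof
    assume "H = pt m"
    then have "coset_act G (inv (r [^] m)) H = coset_act G (inv x) H"
      unfolding pt_def by (metis G coset_act_inv(1) int_pow_closed)
    then have "coset_act G (inv x) H = H"
      using r H by (simp add: subgroup.m_inv_closed subgroup_int_pow_closed)
    then show False using \<open>x \<notin> H\<close> H coset_act_eq_self_iff[of H "inv x"] 
      by (metis G(2) inv_closed inv_inv subgroup.m_inv_closed)
  qed
  then have "card (insert H (pt ` {0..<2 ^ Suc j})) = Suc (2 ^ Suc j)"
    using card_image[OF inj] by (subst card_insert_disjoint) (auto simp: nat_mult_distrib nat_power_eq)
  moreover have "insert H (pt ` {0..<2 ^ Suc j}) \<subseteq> (\<lambda>g. coset_act G g H) ` K"
  proof -
    have "pt m \<in> (\<lambda>g. coset_act G g H) ` K" for m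
    proof
      show "pt m = coset_act G (r [^] m \<otimes> inv x) H" by (simp add: pt_def coset_act_mult)
      show "r [^] m \<otimes> inv x \<in> K"
        using r K x by (meson subgroup.m_closed subgroup.m_inv_closed subgroup_int_pow_closed subset_iff)
    qed
    moreover have "H = coset_act G \<one> H" by simp
    ultimately show ?thesis using subgroup.one_closed[OF K(1)] by blast
  qed
  ultimately have "Suc (2 ^ Suc j) * card H \<le> card K"
    using card_cosets_le[OF H K] by metis
  moreover have "card H > 0" using r K finite_subset card_gt_0_iff by blast
  ultimately show False using card by simp
qed

end

section \<open>Normalisers and subgroups of index 2 in finite 2-groups\<close>

lemma even_of_dvd_2_power:
  fixes d :: nat
  assumes "d dvd 2 ^ k" "d \<noteq> 1" shows "even d"
proof -
  obtain i where "d = 2 ^ i"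
    using assms(1) divides_primepow_nat two_is_prime_nat by blast
  then show ?thesis using assms(2) by (cases i) auto
qed

context group
begin

lemma group_action_cosets:
  assumes H: "subgroup H G" and M: "subgroup M G"
  shows "group_action (G\<lparr>carrier := M\<rparr>) ((\<lambda>g. coset_act G g H) ` carrier G)
           (\<lambda>m. \<lambda>p\<in>(\<lambda>g. coset_act G g H) ` carrier G. coset_act G m p)"
    (is "group_action ?M ?E ?\<phi>")
proof -
  have MG: "M \<subseteq> carrier G" using M subgroup.subset by blast
  have E: "coset_act G m p \<in> ?E" if "m \<in> carrier G" "p \<in> ?E" for m p
    using that by (auto simp flip: coset_act_mult)
  have bij: "?\<phi> m \<in> Bij ?E" if m: "m \<in> M" for m
  proof -
    have "m \<in> carrier G" using m MG by blast
    then have "bij_betw (coset_act G m) ?E ?E"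
      using E by (intro bij_betwI[where g = "coset_act G (inv m)"]) auto
    then have "bij_betw (?\<phi> m) ?E ?E" by (simp cong: bij_betw_cong)
    then show ?thesis by (simp add: Bij_def)
  qed
  have mult: "?\<phi> (m \<otimes> n) = compose ?E (?\<phi> m) (?\<phi> n)" if "m \<in> M" "n \<in> M" for m n
    unfolding compose_def
  proof (rule restrict_ext)
    fix p assume p: "p \<in> ?E"
    have "m \<in> carrier G" "n \<in> carrier G" using that MG by auto
    then show "coset_act G (m \<otimes> n) p = ?\<phi> m (?\<phi> n p)"
      using E[of n p] p by (simp add: coset_act_mult)
  qed
  have "group_hom ?M (BijGroup ?E) ?\<phi>"
    unfolding group_hom_def group_hom_axioms_def
    using bij mult group_BijGroup subgroup.subgroup_is_group[OF M is_group]
    by (simp add: hom_def BijGroup_def)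
  then show ?thesis by (rule group_action.intro)
qed

text \<open>The action of \<open>M\<close> on the cosets of \<open>M\<close> has an even number of fixed points.\<close>

lemma proper_subgroup_of_2_group_normalizer:
  assumes M: "subgroup M G" "M \<noteq> carrier G" and ord: "order G = 2 ^ k"
  shows "\<exists>g \<in> carrier G - M. \<forall>m\<in>M. conj_by G g m \<in> M"
proof -
  let ?E = "(\<lambda>g. coset_act G g M) ` carrier G"
  define \<phi> where "\<phi> = (\<lambda>m. \<lambda>p\<in>?E. coset_act G m p)"
  let ?M = "G\<lparr>carrier := M\<rparr>"
  interpret A: group_action ?M ?E \<phi>
    unfolding \<phi>_def by (rule group_action_cosets) (rule M(1))+
  have fin: "finite (carrier G)" using ord order_gt_0_iff_finite by simp
  have MG: "M \<subseteq> carrier G" using M subgroup.subset by blast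
  have finM: "finite M" using fin MG finite_subset by blast
  have "card M dvd 2 ^ k" using lagrange[OF M(1)] ord by (metis dvd_triv_right)
  have "card M * card ?E = 2 ^ k"
  proof -
    have "\<Union>?E = carrier G"
    proof
      show "\<Union>?E \<subseteq> carrier G"
        using M(1) MG by (auto simp: coset_act_subgroup l_coset_def)
      show "carrier G \<subseteq> \<Union>?E"
        using M(1) lcos_self by (auto simp: coset_act_subgroup)
    qed
    moreover have "card M * card ?E = card (\<Union>?E)"
      using fin card_coset_act[OF M(1)] coset_act_disjoint[OF M(1)] \<open>\<Union>?E = carrier G\<close>
      by (intro card_partition) auto
    ultimately show ?thesis using ord by (simp add: order_def)
  qed
  moreover have "card M < 2 ^ k"
    using ord M MG fin by (metis order_def psubset_card_mono psubsetI)
  ultimately have "card ?E dvd 2 ^ k" "card ?E \<noteq> 1"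
    by (metis dvd_triv_right) (use \<open>card M * card ?E = 2 ^ k\<close> \<open>card M < 2 ^ k\<close> in auto)
  then have evenE: "even (card ?E)"
    using even_of_dvd_2_power by blast
  let ?O = "orbits ?M ?E \<phi>"
  have \<phi>: "\<phi> m p = coset_act G m p" if "p \<in> ?E" for m p
    using that by (simp add: \<phi>_def)
  have ME: "M \<in> ?E" by (rule image_eqI[of _ _ \<one>]) simp_all
  have "\<phi> m M = M" if "m \<in> M" for m
    unfolding \<phi>[OF ME] using that M(1) by simp
  then have "orbit ?M \<phi> M = {M}"
    using subgroup.one_closed[OF M(1)] by (auto simp: orbit_def simp del: coset_act_self)
  then have MO: "{M} \<in> ?O" using ME by (auto simp: orbits_def)
  have "finite ?O" using fin by (simp add: orbits_def)
  have "(\<Sum>p\<in>?O. card p) = card ?E"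
    using A.disjoint_sum[of "\<lambda>_. 1::nat"] fin by simp
  \<comment> \<open>Orbit sizes are powers of 2 and add up to the even number of cosets. Removing
    the fixed point \<open>M\<close> leaves an odd total, hence another orbit of odd size, which is
    a second fixed point.\<close>
  then have "even (1 + (\<Sum>p\<in>?O - {{M}}. card p))"
    using evenE sum.remove[OF \<open>finite ?O\<close> MO, of card] by simp
  then have "\<exists>p \<in> ?O - {{M}}. odd (card p)"
    using dvd_sum[of "?O - {{M}}" 2 card] by auto
  then obtain p where p: "p \<in> ?O" "p \<noteq> {M}" "odd (card p)" by blast
  then obtain q where q: "q \<in> ?E" "p = orbit ?M \<phi> q" by (auto simp: orbits_def)
  have "card p dvd card M"
    unfolding q(2) using dvd_triv_left[of "card (orbit ?M \<phi> q)" "card (stabilizer ?M \<phi> q)"]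
      A.orbit_stabilizer_theorem[OF q(1)] by (simp add: order_def)
  then have "card p dvd 2 ^ k" using \<open>card M dvd 2 ^ k\<close> dvd_trans by blast
  then have "card p = 1"
    using p(3) even_of_dvd_2_power by blast
  moreover have "q \<in> p" using A.orbit_refl[OF q(1)] q(2) by simp
  ultimately have "p = {q}" by (metis card_1_singletonE singletonD)
  obtain g where g: "g \<in> carrier G" "q = coset_act G g M" using q(1) by blast
  have "coset_act G m q = q" if "m \<in> M" for m
  proof -
    have "\<phi> m q \<in> p" using that q(2) by (auto simp: orbit_def)
    then show ?thesis using \<open>p = {q}\<close> \<phi>[OF q(1)] by simp
  qed
  then have "\<forall>m\<in>M. conj_by G (inv g) m \<in> M"
    using g coset_act_fixes_iff[OF M(1)] MG by (metis subsetD)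
  moreover have "inv g \<notin> M"
    using g p(2) \<open>p = {q}\<close> M(1) coset_act_self
    by (metis inv_inv subgroup.m_inv_closed)
  ultimately show ?thesis using g by blast
qed

lemma finite_subgroupI:
  assumes fin: "finite (carrier G)" and H: "H \<subseteq> carrier G" "\<one> \<in> H"
    and mult: "\<And>u v. u \<in> H \<Longrightarrow> v \<in> H \<Longrightarrow> u \<otimes> v \<in> H"
  shows "subgroup H G"
proof (rule subgroupI)
  fix u assume u: "u \<in> H"
  have pow: "u [^] (k::nat) \<in> H" for k
    by (induction k) (use u H mult in auto)
  have "u [^] (order G - 1) \<otimes> u = \<one>"
    using u H fin order_gt_0_iff_finite pow_order_eq_1[of u]
    by (metis Suc_diff_1 nat_pow_Suc subsetD)
  then have "inv u = u [^] (order G - 1)"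
    using u H by (metis inv_equality nat_pow_closed subsetD)
  then show "inv u \<in> H" using pow by simp
qed (use H mult in auto)

text \<open>In a 2-group a maximal proper subgroup is normal, because its normaliser is strictly
  larger. A maximal \<open>M\<close> above \<open>H\<close> cannot contain \<open>x\<close>, as
  \<open>x\<close> and \<open>H\<close> generate the group, and normality makes \<open>M\<close> and
  \<open>x M\<close> together a subgroup, hence everything.\<close>

lemma index_2_subgroup_of_2_group:
  assumes H: "subgroup H G" "x \<in> carrier G" "x \<otimes> x = \<one>" "x \<notin> H"
    and gen: "generate G (insert x H) = carrier G" and ord: "order G = 2 ^ k"
  shows "\<exists>M. subgroup M G \<and> H \<subseteq> M \<and> x \<notin> M \<and> 2 * card M = order G \<and>
           (\<forall>m\<in>M. conj_by G x m \<in> M)"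
proof -
  have fin: "finite (carrier G)" using ord order_gt_0_iff_finite by simp
  define S where "S = {M. subgroup M G \<and> H \<subseteq> M \<and> M \<noteq> carrier G}"
  have S_iff: "M \<in> S \<longleftrightarrow> subgroup M G \<and> H \<subseteq> M \<and> M \<noteq> carrier G" for M
    by (simp add: S_def)
  have "S \<subseteq> Pow (carrier G)" using subgroup.subset S_iff by blast
  then have "finite S" using fin finite_subset by blast
  moreover have "H \<in> S" using H S_iff by blast
  ultimately have "\<exists>M\<in>S. H \<subseteq> M \<and> (\<forall>N\<in>S. M \<subseteq> N \<longrightarrow> M = N)"
    by (rule finite_has_maximal2)
  then obtain M where M: "M \<in> S" "\<forall>N\<in>S. M \<subseteq> N \<longrightarrow> M = N"
    by blast
  then have sub: "subgroup M G" and HM: "H \<subseteq> M" and "M \<noteq> carrier G"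
    using S_iff by blast+
  have MG: "M \<subseteq> carrier G" using sub subgroup.subset by blast
  have x: "x \<notin> M"
  proof
    assume "x \<in> M"
    then have "generate G (insert x H) \<subseteq> M" using HM sub generate_subgroup_incl by blast
    then show False using gen MG \<open>M \<noteq> carrier G\<close> by blast
  qed
  obtain g where g: "g \<in> carrier G - M" "\<forall>m\<in>M. conj_by G g m \<in> M"
    using proper_subgroup_of_2_group_normalizer[OF sub \<open>M \<noteq> carrier G\<close> ord] by blast
  \<comment> \<open>Mapping \<open>M\<close> into itself is enough to define the normaliser, since
    the group is finite.\<close>
  define N where "N = {g \<in> carrier G. \<forall>m\<in>M. conj_by G g m \<in> M}"
  have "subgroup N G"
  proof (rule finite_subgroupI[OF fin])
    show "N \<subseteq> carrier G" "\<one> \<in> N" using fin MG by (auto simp: N_def conj_by_def)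
    show "u \<otimes> v \<in> N" if "u \<in> N" "v \<in> N" for u v
      using that MG by (auto simp: N_def conj_by_conj_by subset_iff)
  qed
  moreover have "M \<subseteq> N"
    using sub MG by (auto simp: N_def conj_by_def intro!: subgroup.m_closed subgroup.m_inv_closed)
  moreover have "M \<noteq> N" using g by (auto simp: N_def)
  ultimately have N: "N = carrier G"
    using M(2) HM S_iff[of N] by (metis subset_trans)
  then have norm: "conj_by G u m \<in> M" if "u \<in> carrier G" "m \<in> M" for u m
    using that by (auto simp: N_def)
  let ?K = "M \<union> (\<lambda>m. x \<otimes> m) ` M"
  have xx [simp]: "x \<otimes> (x \<otimes> m) = m" if "m \<in> carrier G" for m
    using that H by (simp flip: m_assoc)
  have mx: "m \<otimes> (x \<otimes> n) = x \<otimes> (conj_by G x m \<otimes> n)" if "m \<in> carrier G" "n \<in> carrier G" for m n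
    using that H by (simp add: conj_by_def m_assoc inv_involution)
  have xm: "x \<otimes> m \<in> ?K" if "m \<in> M" for m using that by blast
  have "subgroup ?K G"
  proof (rule finite_subgroupI[OF fin])
    show "?K \<subseteq> carrier G" "\<one> \<in> ?K"
      using fin MG H sub finite_subset by (auto simp: subgroup.one_closed)
    have cl: "m \<otimes> n \<in> M" "conj_by G x m \<otimes> n \<in> M" if "m \<in> M" "n \<in> M" for m n
      using that norm H sub by (auto intro: subgroup.m_closed)
    show "u \<otimes> v \<in> ?K" if uv: "u \<in> ?K" "v \<in> ?K" for u v
    proof -
      have [simp]: "m \<in> carrier G" if "m \<in> M" for m using that MG by blast
      have "m \<otimes> n \<in> ?K" "m \<otimes> (x \<otimes> n) \<in> ?K" "x \<otimes> m \<otimes> n \<in> ?K" "x \<otimes> m \<otimes> (x \<otimes> n) \<in> ?K"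
        if mn: "m \<in> M" "n \<in> M" for m n
      proof -
        note [simp] = H(2)
        show "m \<otimes> n \<in> ?K" using cl(1)[OF mn] by (rule UnI1)
        have "x \<otimes> m \<otimes> n = x \<otimes> (m \<otimes> n)" using mn by (simp add: m_assoc)
        then show "x \<otimes> m \<otimes> n \<in> ?K" using xm[OF cl(1)[OF mn]] by (simp only:)
        have 1: "m \<otimes> (x \<otimes> n) = x \<otimes> (conj_by G x m \<otimes> n)" using mn by (intro mx) simp_all
        then show "m \<otimes> (x \<otimes> n) \<in> ?K" using xm[OF cl(2)[OF mn]] by (simp only:)
        have "x \<otimes> m \<otimes> (x \<otimes> n) = x \<otimes> (m \<otimes> (x \<otimes> n))" using mn by (simp add: m_assoc)
        also have "\<dots> = conj_by G x m \<otimes> n" unfolding 1 using mn by (intro xx) simp_all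
        finally show "x \<otimes> m \<otimes> (x \<otimes> n) \<in> ?K" using cl(2)[OF mn] by (simp only: UnI1)
      qed
      then show ?thesis using uv by (elim UnE imageE) (simp_all only:)
    qed
  qed
  moreover have "insert x H \<subseteq> ?K"
    using HM subgroup.one_closed[OF sub] H by (auto intro!: image_eqI[of x _ \<one>])
  ultimately have "carrier G \<subseteq> ?K" using gen generate_subgroup_incl by blast
  then have "carrier G = ?K" using MG H by auto
  moreover have "M \<inter> (\<lambda>m. x \<otimes> m) ` M = {}"
  proof -
    have "x \<in> M" if "m \<in> M" "x \<otimes> m \<in> M" for m
      using that sub H MG inv_solve_right[of x "x \<otimes> m" m]
      by (metis inv_closed m_assoc r_inv r_one subgroup.m_closed subgroup.m_inv_closed subsetD)
    then show ?thesis using x by blast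
  qed
  moreover have "card ((\<lambda>m. x \<otimes> m) ` M) = card M"
    using H MG by (intro card_image inj_onI) (auto simp: subset_iff)
  ultimately have "order G = card M + card M"
    using fin MG finite_subset by (metis card_Un_disjoint finite_Un order_def)
  then show ?thesis using sub HM x norm H(2) by fastforce
qed

end

section \<open>Coset enumeration over the dihedral subgroup\<close>

context involution_triple
begin

abbreviation "A \<equiv> coset_act G a"
abbreviation "B \<equiv> coset_act G b"
abbreviation "C \<equiv> coset_act G c"

lemma act_involutions [simp]: "A (A p) = p" "B (B p) = p" "C (C p) = p"
  by (simp_all flip: coset_act_mult)
lemma act_ca: "C (A p) = A (C p)"
  by (simp add: ca flip: coset_act_mult)
lemma act_baba: "B (A (B (A p))) = A (B (A (B p)))"
  using baba by (simp add: m_assoc flip: coset_act_mult)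
lemma act_D [simp]: "B D = D" "C D = D"
  by (simp_all add: subgroup_D)
lemma act_z: "coset_act G z p = A (B (A (B p)))"
  by (simp add: z_def coset_act_mult)
lemma act_w: "coset_act G w p = A (B (C (B (A p))))"
  by (simp add: w_def coset_act_mult)
lemma act_rot_1: "coset_act G (rot 1) p = B (C p)"
  by (simp add: rot_1 coset_act_mult)
lemma act_rot_2: "coset_act G (rot 2) p = B (C (B (C p)))"
  by (simp add: rot_2 coset_act_mult)
lemma act_rot_4: "coset_act G (rot 4) p = B (C (B (C (B (C (B (C p)))))))"
  using coset_act_mult[of "rot 2" "rot 2" p] by (simp add: rot_add act_rot_2)

lemma act_fixes_iff:
  "g \<in> carrier G \<Longrightarrow> x \<in> carrier G \<Longrightarrow> x \<otimes> x = \<one> \<Longrightarrow>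
   coset_act G g (coset_act G x D) = coset_act G x D \<longleftrightarrow> cj x g \<in> D"
  by (simp add: coset_act_fixes_iff subgroup_D inv_involution)

lemma card_le_of_closed:
  assumes "finite D" "finite P" "D \<in> P" "A ` P \<subseteq> P" "B ` P \<subseteq> P" "C ` P \<subseteq> P"
  shows "finite (carrier G)" "card (carrier G) \<le> card P * card D"
proof -
  have "finite (carrier G) \<and> card (carrier G) \<le> card P * card D"
    using assms(4-6)
    by (intro card_le_of_closed_cosets[OF subgroup_D assms(1) generated _ _ assms(2,3)]) auto
  then show "finite (carrier G)" "card (carrier G) \<le> card P * card D" by simp_all
qed

text \<open>With a list, \<open>length\<close> bounds the number of cosets even if entries of a
  table coincide.\<close>

lemma card_le_of_closed_list:
  assumes "finite D" "D \<in> set ps" "A ` set ps \<subseteq> set ps" "B ` set ps \<subseteq> set ps" "C ` set ps \<subseteq> set ps"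
  shows "finite (carrier G)" "card (carrier G) \<le> length ps * card D"
  using card_le_of_closed[of "set ps"] assms card_length[of ps]
  by (auto intro: order_trans[OF _ mult_right_mono])

lemma card_D_le:
  assumes "rot q = \<one>" "q > 0"
  shows "finite D" "card D \<le> 2 * nat q"
proof -
  have rot: "rot k \<in> rot ` {0..<q}" for k
  proof (rule image_eqI)
    show "rot k = rot (k mod q)"
      using rot_add[of "k mod q" "q * (k div q)"] rot_pow[of q "k div q", symmetric] assms(1)
      by simp
  qed (use assms(2) in simp)
  then have D: "D \<subseteq> rot ` {0..<q} \<union> (\<lambda>x. x \<otimes> c) ` rot ` {0..<q}"
    by (auto simp: D_def)
  then show "finite D" by (rule finite_subset) simp
  have "card D \<le> card (rot ` {0..<q} \<union> (\<lambda>x. x \<otimes> c) ` rot ` {0..<q})"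
    using D by (rule card_mono[rotated]) simp
  also have "\<dots> \<le> card (rot ` {0..<q}) + card ((\<lambda>x. x \<otimes> c) ` rot ` {0..<q})"
    by (rule card_Un_le)
  also have "\<dots> \<le> card (rot ` {0..<q}) + card (rot ` {0..<q})"
    by (intro add_left_mono card_image_le) simp
  also have "\<dots> \<le> 2 * nat q"
    using card_image_le[of "{0..<q}" rot] by simp
  finally show "card D \<le> 2 * nat q" .
qed

text \<open>In the coset tables below \<open>D\<close> plays the role of \<open>p\<^sub>1\<close>; the hypotheses are what closes
  the table.\<close>

lemma card_le_4_cosets:
  assumes "cj z c \<in> D" "finite D"
  shows "finite (carrier G)" "card (carrier G) \<le> 4 * card D"
proof -
  define p2 p3 p4 where p: "p2 = A D" "p3 = B p2" "p4 = A p3"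
  have tab: "A D = p2" "B p2 = p3" "A p3 = p4" "A p2 = D" "B p3 = p2" "A p4 = p3"
    by (simp_all add: p)
  have b4: "B p4 = p4"
    using act_baba[of D] by (simp add: p)
  have c2: "C p2 = p2" by (simp add: p act_ca)
  \<comment> \<open>As \<open>b\<close> fixes \<open>D\<close>, \<open>p4\<close> is the coset
    \<open>z D\<close>, and the hypothesis says that \<open>c\<close> fixes it.\<close>
  have c4: "C p4 = p4"
    using act_fixes_iff[of c z] assms(1) by (simp add: act_z p)
  have c3: "C p3 = p3"
    using c4 tab act_ca by metis
  note t = tab b4 c2 c3 c4
  show "finite (carrier G)" "card (carrier G) \<le> 4 * card D"
    using card_le_of_closed_list[of "[D, p2, p3, p4]"] assms(2) by (simp_all add: t)
qed

lemma act_reflect: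
  assumes "B (C (B (C p))) = p" "B p = p" shows "B (C p) = C p"
  using assms by (metis act_involutions)

text \<open>The first hypothesis says that \<open>r^2\<close> fixes \<open>p4 = z D\<close>, which
  gives \<open>B p6 = p6\<close>. The second says that \<open>r^4\<close> fixes
  \<open>p2 = a D\<close>, which gives \<open>C p7 = p7\<close>. The rest of the table follows from
  \<open>c a = a c\<close> and \<open>(a b)^4 = 1\<close>.\<close>

lemma card_le_8_cosets:
  assumes "cj z (rot 2) \<in> D" "cj a (rot 4) \<in> D" "finite D"
  shows "finite (carrier G)" "card (carrier G) \<le> 8 * card D"
proof -
  define p2 p3 p4 p5 p6 p7 p8 where p: "p2 = A D" "p3 = B p2" "p4 = A p3" "p5 = C p3"
    "p6 = A p5" "p7 = B p5" "p8 = A p7"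
  have tab: "A D = p2" "B p2 = p3" "A p3 = p4" "A p2 = D" "B p3 = p2" "A p4 = p3"
    "C p3 = p5" "C p5 = p3" "A p5 = p6" "A p6 = p5" "B p5 = p7" "B p7 = p5" "A p7 = p8" "A p8 = p7"
    by (simp_all add: p)
  have b4: "B p4 = p4"
    using act_baba[of D] by (simp add: p)
  have c2: "C p2 = p2" by (simp add: p act_ca)
  have c4: "C p4 = p6" using tab act_ca by metis
  then have c6: "C p6 = p4" by (metis act_involutions)
  have "B (C (B (C p4))) = p4"
    using act_fixes_iff[of "rot 2" z] assms(1) by (simp add: act_z act_rot_2 p)
  then have b6: "B p6 = p6" using act_reflect b4 c4 by metis
  have "B (C (B (C (B (C (B (C p2))))))) = p2"
    using act_fixes_iff[of "rot 4" a] assms(2) by (simp add: act_rot_4 p)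
  then have c7: "C p7 = p7" using c2 tab by (metis act_involutions)
  have c8: "C p8 = p8" using c7 tab act_ca by metis
  have b8: "B p8 = p8" using act_baba[of p6] b6 tab by metis
  note t = tab b4 c2 c4 c6 b6 c7 c8 b8
  show "finite (carrier G)" "card (carrier G) \<le> 8 * card D"
    using card_le_of_closed_list[of "[D, p2, p3, p4, p5, p6, p7, p8]"] assms(3) by (simp_all add: t)
qed

text \<open>Conjugation by \<open>a\<close> maps \<open>r^4\<close> to one of its powers, and
  \<open>b\<close> and \<open>c\<close> invert it. The powers of \<open>r^4\<close> therefore form a
  normal subgroup, and since it lies in \<open>D\<close> it fixes every coset of
  \<open>D\<close>.\<close>

lemma rot_4_acts_trivially:
  assumes e: "cj a (rot 4) = rot (4 * e)" and g: "g \<in> carrier G"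
  shows "coset_act G (rot 4) (coset_act G g D) = coset_act G g D"
proof -
  have "\<exists>l. cj g (rot (4 * k)) = rot (4 * l)" if "g \<in> generate G {a, b, c}" for g k
    using that
  proof (induction arbitrary: k)
    case one
    show ?case by (rule exI[of _ k]) (simp add: conj_by_def)
  next
    case (incl g)
    have "cj a (rot (4 * k)) = rot (4 * (e * k))"
      using cj_rot_mult[OF a e, of k] by (simp add: mult.assoc)
    then show ?case
      using incl cj_b_rot[of "4 * k"] cj_c_rot[of "4 * k"]
      by (metis emptyE insertE mult_minus_right)
  next
    case (inv g)
    have "cj a (rot (4 * k)) = rot (4 * (e * k))"
      using cj_rot_mult[OF a e, of k] by (simp add: mult.assoc)
    then show ?case
      using inv cj_b_rot[of "4 * k"] cj_c_rot[of "4 * k"]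
      by (metis emptyE insertE inv_a inv_b inv_c mult_minus_right)
  next
    case (eng g h)
    then show ?case
      using generated by (metis conj_by_conj_by rot_closed)
  qed
  then have "cj (inv g) (rot (4 * 1)) \<in> D"
    using generated g by (metis inv_closed rot_in_D)
  then show ?thesis
    using g by (simp add: coset_act_fixes_iff subgroup_D)
qed

text \<open>The table is closed by \<open>r^4\<close> fixing \<open>p2\<close>, \<open>p4\<close>
  and \<open>p13\<close>, and by \<open>r^2\<close> fixing \<open>p9 = w D\<close>. Each time the
  closed path of letters \<open>b\<close> and \<open>c\<close> is followed from both ends until the
  ends meet, which forces the entry in the middle.\<close>

lemma card_le_16_cosets:
  assumes "cj a (rot 4) = rot (4 * e)" "cj w (rot 2) \<in> D" "finite D"
  shows "finite (carrier G)" "card (carrier G) \<le> 16 * card D"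
proof -
  define p2 p3 p4 p5 p6 p7 p8 p9 where p: "p2 = A D" "p3 = B p2" "p4 = A p3" "p5 = C p3"
    "p6 = A p5" "p7 = B p5" "p8 = B p6" "p9 = A p7"
  define p10 p11 p12 p13 p14 p15 p16 where p': "p10 = A p8" "p11 = C p8" "p12 = B p9"
    "p13 = B p10" "p14 = A p11" "p15 = B p14" "p16 = A p15"
  have tab: "A D = p2" "B p2 = p3" "A p3 = p4" "A p2 = D" "B p3 = p2" "A p4 = p3"
    "C p3 = p5" "C p5 = p3" "A p5 = p6" "A p6 = p5" "B p5 = p7" "B p7 = p5" "A p7 = p9" "A p9 = p7"
    "B p6 = p8" "B p8 = p6" "A p8 = p10" "A p10 = p8" "C p8 = p11" "C p11 = p8"
    "B p9 = p12" "B p12 = p9" "B p10 = p13" "B p13 = p10" "A p11 = p14" "A p14 = p11"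
    "B p14 = p15" "B p15 = p14" "A p15 = p16" "A p16 = p15"
    by (simp_all add: p p')
  have b4: "B p4 = p4"
    using act_baba[of D] by (simp add: p)
  have c2: "C p2 = p2" by (simp add: p act_ca)
  have c4: "C p4 = p6" using tab act_ca by metis
  then have c6: "C p6 = p4" by (metis act_involutions)
  have r4: "B (C (B (C (B (C (B (C (coset_act G g D)))))))) = coset_act G g D" if "g \<in> carrier G" for g
    using rot_4_acts_trivially[OF assms(1) that] by (simp add: act_rot_4)
  have c7: "C p7 = p7" using r4[OF a] c2 tab by (metis act_involutions)
  have c9: "C p9 = p9" using c7 tab act_ca by metis
  have p9: "p9 = coset_act G w D" by (simp add: p act_w)
  have "B (C (B (C p9))) = p9"
    using act_fixes_iff[of "rot 2" w] assms(2) by (simp add: p9 act_rot_2)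
  then have c12: "C p12 = p12" using c9 tab by (metis act_involutions)
  have p4: "p4 = coset_act G (a \<otimes> (b \<otimes> a)) D"
    by (simp add: p coset_act_mult)
  have "B (C (B (C (B (C (B (C p4))))))) = p4"
    unfolding p4 by (rule r4) simp
  then have b11: "B p11 = p11" using b4 c4 tab by (metis act_involutions)
  have a12: "A p12 = p13" using act_baba[of p5] tab by metis
  then have a13: "A p13 = p12" by (metis act_involutions)
  have c13: "C p13 = p13" using a12 c12 act_ca by metis
  have c10: "C p10 = p14" using tab act_ca by metis
  then have c14: "C p14 = p10" by (metis act_involutions)
  have p13: "p13 = coset_act G (a \<otimes> (b \<otimes> w)) D"
    using a12 tab by (simp add: p9 coset_act_mult)
  have "B (C (B (C (B (C (B (C p13))))))) = p13"
    unfolding p13 by (rule r4) simp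
  then have c15: "C p15 = p15" using c13 c10 c14 tab by (metis act_involutions)
  have c16: "C p16 = p16" using c15 tab act_ca by metis
  have b16: "B p16 = p16" using act_baba[of p11] b11 tab by metis
  note t = tab b4 c2 c4 c6 c7 c9 c12 b11 a12 a13 c13 c10 c14 c15 c16 b16
  show "finite (carrier G)" "card (carrier G) \<le> 16 * card D"
    using card_le_of_closed_list[of "[D, p2, p3, p4, p5, p6, p7, p8, p9, p10, p11, p12, p13, p14, p15, p16]"]
      assms(3) by (simp_all add: t)
qed

end

section \<open>Relations forced by membership in the dihedral subgroup\<close>

context involution_triple
begin

lemma commutator_z_c: "commutator G z c = cj z c \<otimes> c"
  by (simp add: commutator_def conj_by_def m_assoc)

lemma commutator_z_rot: "commutator G z (rot k) = cj z (rot (- k)) \<otimes> rot k"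
  by (simp add: commutator_def conj_by_def m_assoc inv_rot)

lemma commutator_a_rot: "commutator G a (rot k) = cj a (rot (- k)) \<otimes> rot k"
  by (simp add: commutator_def conj_by_def m_assoc inv_rot)

lemma rot_right_cancel: "x \<in> carrier G \<Longrightarrow> x \<otimes> rot i = rot j \<longleftrightarrow> x = rot (j - i)"
  using inv_solve_right[of x "rot j" "rot i"] unfolding inv_rot rot_add by auto

lemma card_le_of_commutator_z_c:
  assumes "commutator G z c = rot k" "finite D"
  shows "finite (carrier G)" "card (carrier G) \<le> 4 * card D"
proof -
  have "cj z c = rot k \<otimes> c"
    using assms(1) inv_solve_right[of "cj z c" "rot k" c] unfolding commutator_z_c inv_c by simp
  then have "cj z c \<in> D" by (simp add: rot_c_in_D)
  then show "finite (carrier G)" "card (carrier G) \<le> 4 * card D"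
    using card_le_4_cosets assms(2) by auto
qed

text \<open>The relator gives \<open>z r^2 z = r^(2 - k)\<close>, so \<open>a\<close> fixes
  \<open>r^(4 - k)\<close> by \<open>cj_a_fixes\<close>. Since \<open>8 dvd k\<close>, the exponent
  \<open>4 - k\<close> is 4 times an odd number, and \<open>r^4\<close> is recovered as a power of
  \<open>r^(4 - k)\<close>.\<close>

lemma card_le_of_commutator_z_rot:
  assumes "commutator G z (rot 2) = rot k" "rot (2 * k) = \<one>" "8 dvd k" "finite D"
  shows "finite (carrier G)" "card (carrier G) \<le> 8 * card D"
proof -
  obtain u where k: "k = 8 * u" using assms(3) by blast
  have "cj z (rot (- 2)) = rot (k - 2)"
    using assms(1) by (simp add: commutator_z_rot rot_right_cancel)
  from cj_rot_minus[OF z_closed this] have z2: "cj z (rot 2) = rot (2 - k)" by simp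
  \<comment> \<open>The factor \<open>1 + 2 * u\<close> is an approximate inverse of
    \<open>1 - 2 * u\<close>: the product of the exponents is \<open>4 - 16 * u^2\<close>, and
    \<open>16 * u = 2 * k\<close> is an exponent that kills \<open>r\<close>.\<close>
  have "cj a (rot ((4 - k) * (1 + 2 * u))) = rot ((4 - k) * (1 + 2 * u))"
    using cj_a_fixes[OF z2] by (intro cj_rot_mult) (simp_all add: add_diff_eq)
  moreover have "rot ((4 - k) * (1 + 2 * u)) = rot 4"
  proof -
    have "rot ((4 - k) * (1 + 2 * u)) = rot 4 \<otimes> rot (2 * k * (- u))"
      by (simp add: rot_add k algebra_simps)
    also have "rot (2 * k * (- u)) = \<one>"
      by (metis assms(2) int_pow_one rot_pow)
    finally show ?thesis by simp
  qed
  ultimately have "cj a (rot 4) \<in> D" by simp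
  then show "finite (carrier G)" "card (carrier G) \<le> 8 * card D"
    using card_le_8_cosets assms(4) z2 by auto
qed

text \<open>With \<open>S = a r^2 a\<close> the first commutator is \<open>S^(-1) r^2\<close>. That
  its square is a power of \<open>r\<close> expresses \<open>S r^2 S^(-1)\<close> as
  \<open>S^2\<close> times a power of \<open>r\<close>, and the second commutator makes
  \<open>S^2 = a r^4 a\<close> a power of \<open>r\<close>. Because \<open>w = S c\<close>, this
  puts \<open>w r^2 w\<close> into \<open>D\<close>.\<close>

lemma card_le_of_commutator_a_rot:
  assumes k: "commutator G a (rot 2) \<otimes> commutator G a (rot 2) = rot k"
    and l: "commutator G a (rot 4) = rot l" "4 dvd l" and D: "finite D"
  shows "finite (carrier G)" "card (carrier G) \<le> 16 * card D"
proof -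
  obtain u where u: "l = 4 * u" using l by blast
  have "cj a (rot (- 4)) = rot (l - 4)"
    using l by (simp add: commutator_a_rot rot_right_cancel)
  from cj_rot_minus[OF a this] have a4: "cj a (rot 4) = rot (4 * (1 - u))"
    by (simp add: u algebra_simps)
  define S where "S = cj a (rot 2)"
  have [simp]: "S \<in> carrier G" by (simp add: S_def)
  have S2: "S \<otimes> S = rot (4 - l)"
    using a4 by (simp add: S_def u algebra_simps rot_add flip: conj_by_mult)
  have com: "commutator G a (rot 2) = inv S \<otimes> rot 2"
    by (simp add: commutator_a_rot S_def conj_by_inv flip: inv_rot)
  have "inv S \<otimes> (rot 2 \<otimes> inv S) \<otimes> rot 2 = rot k"
    using k by (simp add: com m_assoc)
  then have "inv S \<otimes> (rot 2 \<otimes> inv S) = rot (k - 2)"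
    by (simp add: rot_right_cancel)
  then have "rot 2 \<otimes> inv S = S \<otimes> rot (k - 2)"
    using inv_solve_left[of "rot (k - 2)" S "rot 2 \<otimes> inv S"] by simp
  then have "cj S (rot 2) = S \<otimes> S \<otimes> rot (k - 2)"
    by (simp add: conj_by_def m_assoc)
  then have "cj S (rot 2) = rot (2 + k - l)"
    by (simp add: S2 rot_add algebra_simps)
  then have "cj w (rot 2) \<in> D"
    using cj_rot_minus[of S 2] by (simp add: cj_w_rot flip: S_def)
  then show "finite (carrier G)" "card (carrier G) \<le> 16 * card D"
    using card_le_16_cosets[OF a4] D by auto
qed

lemma central_of_commutes_a:
  assumes "x \<in> carrier G" "a \<otimes> x = x \<otimes> a" "b \<otimes> x = x \<otimes> b" "c \<otimes> x = x \<otimes> c" "g \<in> carrier G"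
  shows "g \<otimes> x = x \<otimes> g"
proof -
  have "g \<in> generate G {a, b, c}" using assms(5) generated by simp
  then show ?thesis
  proof induction
    case (eng g h)
    then have "g \<in> carrier G" "h \<in> carrier G" using generated by auto
    then have "g \<otimes> h \<otimes> x = g \<otimes> (x \<otimes> h)" "g \<otimes> (x \<otimes> h) = x \<otimes> g \<otimes> h"
      using eng assms(1) by (simp add: m_assoc, simp flip: m_assoc)
    then show ?case
      using \<open>g \<in> carrier G\<close> \<open>h \<in> carrier G\<close> assms(1) by (simp add: m_assoc)
  qed (use assms in auto)
qed

end

section \<open>Rotations of order exactly \<open>2 ^ p\<close>\<close>

locale involution_triple_2 = involution_triple +
  fixes p :: nat
  assumes rot_eq_one: "rot k = \<one> \<longleftrightarrow> 2 ^ p dvd k"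
begin

lemma rot_eq_iff: "rot i = rot j \<longleftrightarrow> 2 ^ p dvd i - j"
proof -
  have "rot i = rot j \<longleftrightarrow> rot i \<otimes> rot (- j) = \<one>"
    using inv_solve_right[of \<one> "rot i" "rot j"] unfolding inv_rot by auto
  then show ?thesis by (simp add: rot_add rot_eq_one)
qed

lemma rot_eq_one_or_half:
  assumes "2 ^ p dvd 2 * k" "p > 0"
  shows "rot k = \<one> \<or> rot k = rot (2 ^ (p - 1))"
proof -
  have "2 ^ (p - 1) * 2 dvd k * 2"
    using assms by (cases p) (simp_all add: mult.commute)
  then obtain u where k: "k = 2 ^ (p - 1) * u" using dvd_times_right_cancel_iff by auto
  have p2: "2 ^ p = (2::int) * 2 ^ (p - 1)" using assms(2) by (cases p) auto
  show ?thesis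
  proof (cases "even u")
    case True
    then show ?thesis unfolding rot_eq_one k p2 by auto
  next
    case False
    then obtain v where "u = 2 * v + 1" by (elim oddE)
    then have "k - 2 ^ (p - 1) = 2 * 2 ^ (p - 1) * v" by (simp add: k algebra_simps)
    then show ?thesis unfolding rot_eq_iff p2 by simp
  qed
qed

lemma small_dvd:
  assumes "(2::int) ^ p dvd 2 ^ i * k" "i + j \<le> p" shows "2 ^ j dvd k"
proof -
  have "(2::int) ^ (i + j) dvd 2 ^ i * k"
    using assms le_imp_power_dvd dvd_trans by blast
  then show ?thesis by (simp add: power_add)
qed

lemma rot_small:
  assumes "i < p" shows "rot (2 ^ i) \<noteq> \<one>" "rot (- (2 ^ i)) \<noteq> \<one>"
  using assms dvd_power_iff[of "2::int" p i] by (simp_all add: rot_eq_one)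

lemma conj_rot_in_D:
  assumes g: "g \<in> carrier G" and mem: "cj g (rot d) \<in> D" and d: "rot (2 * d) \<noteq> \<one>"
  shows "\<exists>e. cj g (rot d) = rot e"
proof -
  have "cj g (rot d) \<otimes> cj g (rot d) = cj g (rot (2 * d))"
    using g by (simp add: rot_add flip: conj_by_mult)
  also have "\<dots> \<noteq> \<one>"
    using d g by (simp add: conj_by_eq_iff)
  finally show ?thesis using D_square[OF mem] by auto
qed

text \<open>Here \<open>z r z = r^(e - 1)\<close>, and \<open>z\<close> centralises
  \<open>r^2\<close>, which determines \<open>e\<close> up to half the order of \<open>r\<close>. As
  \<open>z\<close> commutes with \<open>b\<close>, \<open>z r z = b (z c z)\<close> translates this
  into a statement about \<open>c\<close>.\<close>

lemma commutator_z_c_cases: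
  assumes p: "p \<ge> 3" and a2: "cj a (rot 2) \<in> D"
  shows "commutator G z c = \<one> \<or> commutator G z c = rot (2 ^ (p - 1))"
proof -
  obtain e where e: "cj a (rot 2) = rot e"
    using conj_rot_in_D[OF a a2] rot_small[of 2] p by auto
  have y: "cj z (rot 1) = rot (e - 1)"
    using e by (simp add: cj_a_rot_2 rot_right_cancel)
  have "rot 2 = rot (2 * (e - 1))"
    using cj_z_fixes[OF e] cj_z_rot_2 by (simp add: y rot_add)
  then have d: "2 ^ p dvd 2 * (2 - e)"
    by (simp add: rot_eq_iff algebra_simps)
  have "cj z (rot 1) = b \<otimes> cj z c"
    unfolding conj_by_def inv_z by (simp add: rot_1 z_def word_simps)
  then have "cj z c = b \<otimes> rot (e - 1)" using y by (metis bb' conj_by_closed c z_closed)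
  also have "\<dots> = rot (2 - e) \<otimes> c"
    by (subst b_eq) (simp add: m_assoc c_rot rot_add')
  finally have "commutator G z c = rot (2 - e)"
    by (simp add: commutator_z_c m_assoc)
  then show ?thesis using rot_eq_one_or_half[OF d] p by simp
qed

lemma commutator_z_rot_cases:
  assumes p: "p \<ge> 4" and a4: "cj a (rot 4) \<in> D" and z2: "cj z (rot 2) \<in> D"
  shows "commutator G z (rot 2) = \<one> \<or> commutator G z (rot 2) = rot (2 ^ (p - 1))"
proof -
  obtain e where e: "cj a (rot 4) = rot e"
    using conj_rot_in_D[OF a a4] rot_small[of 3] p by auto
  obtain x where x: "cj z (rot 2) = rot x"
    using conj_rot_in_D[OF z_closed z2] rot_small[of 2] p by auto
  have "rot 4 = rot (x * 2)"
    using cj_z_fixes[OF e] cj_rot_mult[OF z_closed x, of 2] by simp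
  then have d: "2 ^ p dvd 2 * (2 - x)"
    by (simp add: rot_eq_iff algebra_simps)
  have "commutator G z (rot 2) = rot (2 - x)"
    using cj_rot_minus[OF z_closed x] by (simp add: commutator_z_rot rot_add)
  then show ?thesis using rot_eq_one_or_half[OF d] p by simp
qed

text \<open>The element \<open>r^m\<close> has order at most 2. It equals its inverse, so
  \<open>b\<close> and \<open>c\<close> fix it; if it is nontrivial, it is the only involution among
  the powers of \<open>r\<close>, so \<open>a\<close> fixes it as well.\<close>

lemma involution_in_rot_central:
  assumes m: "2 ^ p dvd 2 * m" and am: "cj a (rot m) \<in> range rot" and g: "g \<in> carrier G"
  shows "g \<otimes> rot m = rot m \<otimes> g"
proof (rule central_of_commutes_a)
  have "rot (- m) = rot m" unfolding rot_eq_iff using m by (simp add: dvd_diff_commute)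
  then have "cj b (rot m) = rot m" "cj c (rot m) = rot m"
    unfolding cj_b_rot cj_c_rot by simp_all
  then show "b \<otimes> rot m = rot m \<otimes> b" "c \<otimes> rot m = rot m \<otimes> c"
    using conj_by_eq_iff[OF b rot_closed rot_closed] conj_by_eq_iff[OF c rot_closed rot_closed]
    by blast+
  show "a \<otimes> rot m = rot m \<otimes> a"
  proof (cases "p = 0 \<or> rot m = \<one>")
    case True
    then have "rot m = \<one>" by (metis rot_eq_one power_0 one_dvd)
    then show ?thesis by simp
  next
    case False
    obtain f where f: "cj a (rot m) = rot f" using am by (elim rangeE)
    have "rot (f * 2) = \<one>"
      using cj_rot_mult[OF a f, of 2] m
      by (metis conj_by_one a mult.commute rot_eq_one)
    then have f2: "2 ^ p dvd 2 * f" by (simp add: rot_eq_one mult.commute)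
    have "rot f \<noteq> \<one>"
      using f False by (metis conj_by_one conj_by_twice aa a rot_closed)
    then have "rot f = rot m"
      using rot_eq_one_or_half[OF m] rot_eq_one_or_half[OF f2] False by auto
    then show ?thesis using f by (simp add: conj_by_eq_iff)
  qed
qed (use g in auto)

end

context involution_triple_2
begin

text \<open>Put \<open>R = r\<^sup>2\<close> and let \<open>S, T, U\<close> be the conjugates of \<open>R\<close> by \<open>a\<close>, \<open>r a\<close> and \<open>a r a\<close> (so also by
  \<open>z\<close>). They commute up to the central involution \<open>\<tau>\<close>, and squaring \<open>S T = \<tau> R U\<close> pins down \<open>S\<^sup>2\<close>.\<close>

lemma commutator_a_rot_cases:
  assumes p: "p \<ge> 4" and a4: "cj a (rot 4) \<in> D" and w2: "cj w (rot 2) \<in> D"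
  shows "\<exists>k l. commutator G a (rot 2) \<otimes> commutator G a (rot 2) = rot k \<and>
           commutator G a (rot 4) = rot l \<and> 2 ^ p dvd 2 * k \<and> 2 ^ p dvd 2 * l"
proof -
  obtain e where e: "cj a (rot 4) = rot e"
    using conj_rot_in_D[OF a a4] rot_small[of 3] p by auto
  have w4: "cj w (rot 4) = rot (- 4)" by (rule cj_w_inverts[OF e])
  obtain x where x: "cj w (rot 2) = rot x"
    using conj_rot_in_D[OF w_closed w2] rot_small[of 2] p by auto
  have "rot (- 4) = rot (x * 2)"
    using w4 cj_rot_mult[OF w_closed x, of 2] by simp
  \<comment> \<open>The factor \<open>r^m\<close>, of order at most 2, measures how far
    \<open>w\<close> is from inverting \<open>r^2\<close>.\<close>
  define m where "m = - x - 2"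
  have m: "2 ^ p dvd 2 * m"
  proof -
    have "2 * m = - 4 - x * 2" by (simp add: m_def)
    then show ?thesis using \<open>rot (- 4) = rot (x * 2)\<close> unfolding rot_eq_iff by simp
  qed
  define S y T U where "S = cj a (rot 2)" and "y = cj z (rot 1)" and "T = rot 1 \<otimes> y" and "U = y \<otimes> y"
  have cl [simp]: "S \<in> carrier G" "y \<in> carrier G" "T \<in> carrier G" "U \<in> carrier G"
    by (simp_all add: S_def y_def T_def U_def)
  have S: "S = y \<otimes> rot 1" by (simp add: S_def y_def cj_a_rot_2)
  have U: "U = cj z (rot 2)" by (simp add: U_def y_def cj_z_rot_2)
  have UT: "cj a T = U" by (simp add: U cj_z_rot_2' T_def y_def)
  have ST: "cj (rot 1) S = T" by (simp add: conj_by_eq_iff S T_def m_assoc)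
  define \<tau> where "\<tau> = rot m"
  have \<tau>cl [simp]: "\<tau> \<in> carrier G" by (simp add: \<tau>_def)
  have central: "g \<otimes> \<tau> = \<tau> \<otimes> g" if "g \<in> carrier G" for g
    unfolding \<tau>_def
  proof (rule involution_in_rot_central[OF m _ that])
    \<comment> \<open>A multiple of 4 is wanted because \<open>a\<close> is only known to send
      powers of \<open>r^4\<close> to powers of \<open>r\<close>.\<close>
    have "2 ^ 2 dvd m" using small_dvd[of 1 m 2] m p by simp
    then obtain m' where "m = 4 * m'" by auto
    then show "cj a (rot m) \<in> range rot" using cj_rot_mult[OF a e, of m'] by simp
  qed
  have central': "g \<otimes> (\<tau> \<otimes> h) = \<tau> \<otimes> (g \<otimes> h)" if "g \<in> carrier G" "h \<in> carrier G" for g h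
    using that central by (simp flip: m_assoc)
  have \<tau>\<tau> [simp]: "\<tau> \<otimes> \<tau> = \<one>" using m by (simp add: \<tau>_def rot_add rot_eq_one flip: mult_2)
  have \<tau>\<tau>' [simp]: "\<tau> \<otimes> (\<tau> \<otimes> g) = g" if "g \<in> carrier G" for g
    using that by (simp flip: m_assoc)
  have cj\<tau> [simp]: "cj g \<tau> = \<tau>" if "g \<in> carrier G" for g
    using that by (simp add: conj_by_eq_iff central)
  have SR: "S \<otimes> rot 2 = \<tau> \<otimes> (rot 2 \<otimes> S)"
  proof -
    have "cj S (rot (- 2)) = rot x" using x by (simp add: cj_w_rot S_def)
    from cj_rot_minus[OF cl(1) this] have "cj S (rot 2) = rot m \<otimes> rot 2"
      by (simp add: rot_add m_def)
    then show ?thesis by (simp add: conj_by_eq_iff \<tau>_def m_assoc)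
  qed
  have TR: "T \<otimes> rot 2 = \<tau> \<otimes> (rot 2 \<otimes> T)"
  proof -
    have "cj (rot 1) (rot 2) = rot 2" by (simp add: conj_by_eq_iff rot_add)
    then show ?thesis
      using arg_cong[OF SR, of "cj (rot 1)"] by (simp add: conj_by_mult ST)
  qed
  have US: "U \<otimes> S = \<tau> \<otimes> (S \<otimes> U)"
    using arg_cong[OF TR, of "cj a"] by (simp add: conj_by_mult UT flip: S_def)
  have yR: "y \<otimes> rot 2 = \<tau> \<otimes> (rot 2 \<otimes> y)"
  proof -
    have "y = S \<otimes> rot (- 1)" by (simp add: S m_assoc rot_add)
    then have "y \<otimes> rot 2 = S \<otimes> rot 2 \<otimes> rot (- 1)" by (simp add: m_assoc rot_add)
    also have "\<dots> = \<tau> \<otimes> (rot 2 \<otimes> y)" by (simp add: SR m_assoc \<open>y = S \<otimes> rot (- 1)\<close>)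
    finally show ?thesis .
  qed
  have yR': "y \<otimes> (rot 2 \<otimes> g) = \<tau> \<otimes> (rot 2 \<otimes> (y \<otimes> g))" if "g \<in> carrier G" for g
    using that arg_cong[OF yR, of "\<lambda>u. u \<otimes> g"] by (simp add: m_assoc)
  have prod: "S \<otimes> T = \<tau> \<otimes> (rot 2 \<otimes> U)"
  proof -
    have "S \<otimes> T = y \<otimes> (rot 2 \<otimes> y)" by (simp add: S T_def m_assoc rot_add')
    then show ?thesis by (simp add: yR' U_def)
  qed
  have UR: "U \<otimes> rot 2 = rot 2 \<otimes> U"
    by (simp add: U_def m_assoc yR yR' central'[of y])
  have S2: "S \<otimes> S = rot e"
    using e by (simp add: S_def rot_add flip: conj_by_mult)
  have T2: "T \<otimes> T = rot e"
  proof -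
    have "T \<otimes> T = cj (rot 1) (S \<otimes> S)" by (simp add: conj_by_mult ST)
    then show ?thesis by (simp add: S2 conj_by_eq_iff rot_add add.commute)
  qed
  have U2: "U \<otimes> U = rot 4"
    using cj_z_fixes[OF e] by (simp add: U rot_add flip: conj_by_mult)
  \<comment> \<open>The product \<open>U S T\<close> is evaluated twice, by moving \<open>U\<close>
    past \<open>S\<close> and by \<open>prod\<close>. The resulting value of \<open>S U T\<close> is
    what remains when \<open>S^2 T^2\<close> is rearranged below.\<close>
  have "\<tau> \<otimes> (S \<otimes> (U \<otimes> T)) = U \<otimes> (S \<otimes> T)"
    using arg_cong[OF US, of "\<lambda>u. u \<otimes> T"] by (simp add: m_assoc)
  also have "\<dots> = \<tau> \<otimes> (U \<otimes> rot 2 \<otimes> U)"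
    by (simp add: prod central'[of U] m_assoc)
  also have "U \<otimes> rot 2 \<otimes> U = rot 6"
    by (simp add: UR m_assoc U2 rot_add)
  finally have SUT: "S \<otimes> (U \<otimes> T) = rot 6" by simp
  have "rot (e + e) = S \<otimes> (S \<otimes> T) \<otimes> T"
    by (simp add: m_assoc T2) (simp add: S2 rot_add flip: m_assoc)
  also have "\<dots> = \<tau> \<otimes> (S \<otimes> rot 2 \<otimes> (U \<otimes> T))"
    by (simp add: prod central'[of S] m_assoc)
  also have "\<dots> = rot 2 \<otimes> (S \<otimes> (U \<otimes> T))"
    by (simp add: SR m_assoc)
  also have "\<dots> = rot 8"
    by (simp add: SUT rot_add)
  finally have e8: "2 ^ p dvd 2 * (4 - e)"
    by (simp add: rot_eq_iff algebra_simps dvd_diff_commute)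
  define X where "X = commutator G a (rot 2)"
  have X: "X = inv S \<otimes> rot 2"
    by (simp add: X_def commutator_a_rot S_def conj_by_inv flip: inv_rot)
  then have Xcl [simp]: "X \<in> carrier G" by simp
  have SX: "S \<otimes> X = rot 2" by (simp add: X flip: m_assoc)
  have "rot e \<otimes> (X \<otimes> X) = S \<otimes> (S \<otimes> X \<otimes> X)"
    by (simp add: m_assoc flip: S2)
  also have "\<dots> = S \<otimes> rot 2 \<otimes> X" by (simp add: SX m_assoc)
  also have "\<dots> = \<tau> \<otimes> (rot 2 \<otimes> (S \<otimes> X))" by (simp add: SR m_assoc)
  also have "\<dots> = rot (m + 4)" by (simp add: SX rot_add \<tau>_def)
  finally have "X \<otimes> X = inv (rot e) \<otimes> rot (m + 4)"
    using inv_solve_left[of "X \<otimes> X" "rot e" "rot (m + 4)"] by simp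
  then have "X \<otimes> X = rot (m + (4 - e))" by (simp add: inv_rot rot_add algebra_simps)
  moreover have "commutator G a (rot 4) = rot (4 - e)"
    using cj_rot_minus[OF a e] by (simp add: commutator_a_rot rot_add)
  moreover have "2 ^ p dvd 2 * (m + (4 - e))"
    using m e8 by (simp only: distrib_left dvd_add)
  ultimately show ?thesis using e8 unfolding X_def by blast
qed

text \<open>\<open>z\<close> centralises \<open>r^8\<close>, so \<open>4 * x\<close> and 8 agree
  modulo \<open>2 ^ p\<close>, and \<open>p \<ge> 5\<close> gives \<open>8 dvd 2 - x\<close>. Then
  \<open>2 + x\<close> is 4 times an odd number, so \<open>r^(2 + x)\<close>, which \<open>a\<close>
  fixes by \<open>cj_a_fixes\<close>, has \<open>r^4\<close> among its powers.\<close>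

lemma conj_a_rot_4_of_conj_z:
  assumes p: "p \<ge> 5" and a8: "cj a (rot 8) \<in> D" and z2: "cj z (rot 2) \<in> D"
  shows "cj a (rot 4) \<in> D"
proof -
  obtain e where e: "cj a (rot 8) = rot e"
    using conj_rot_in_D[OF a a8] rot_small[of 4] p by auto
  obtain x where x: "cj z (rot 2) = rot x"
    using conj_rot_in_D[OF z_closed z2] rot_small[of 2] p by auto
  have "rot 8 = rot (x * 4)"
    using cj_z_fixes[OF e] cj_rot_mult[OF z_closed x, of 4] by simp
  then have "2 ^ p dvd 2 ^ 2 * (2 - x)" by (simp add: rot_eq_iff algebra_simps)
  then have "2 ^ 3 dvd 2 - x" by (rule small_dvd) (use p in simp)
  then obtain v where v: "2 - x = 8 * v" by auto
  define u where "u = 1 - 2 * v"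
  have u: "2 + x = 4 * u" using v by (simp add: u_def)
  have "coprime u (2 ^ p)" by (simp add: u_def)
  then obtain i j where "u * i + 2 ^ p * j = 1"
    by (metis bezout_int coprime_imp_gcd_eq_1 mult.commute)
  then have "4 * (u * i + 2 ^ p * j) = 4" by simp
  then have "(2 + x) * i - 4 = 2 ^ p * (- 4 * j)" unfolding u by (simp add: algebra_simps)
  then have "rot 4 = rot ((2 + x) * i)" unfolding rot_eq_iff by (metis dvd_diff_commute dvd_triv_left)
  then have "cj a (rot 4) = rot ((2 + x) * i)"
    using cj_rot_mult[OF a cj_a_fixes[OF x], of i] by simp
  then show ?thesis by simp
qed

text \<open>Let \<open>S = a r^2 a\<close>. Since \<open>w = S c\<close>, the hypothesis gives
  \<open>S r S^(-1) = r^m\<close>. As \<open>w\<close> inverts \<open>r^8\<close>,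
  \<open>m = 1 + 4 * j\<close>. As \<open>S^4 = a r^8 a\<close> is a power of \<open>r\<close>,
  \<open>m^4\<close> is 1 modulo 32; it is also \<open>1 + 16 * j\<close> modulo 32, so
  \<open>j\<close> is even. Hence \<open>r^(1 - m)\<close> is a power of \<open>r^8\<close>, and
  \<open>z r^2 z = a r^(1 - m) S a\<close> lies in \<open>D\<close>, which is the situation of the
  preceding lemma.\<close>

lemma conj_a_rot_4_of_conj_w:
  assumes p: "p \<ge> 5" and a8: "cj a (rot 8) \<in> D" and w1: "cj w (rot 1) \<in> D"
  shows "cj a (rot 4) \<in> D"
proof (rule conj_a_rot_4_of_conj_z[OF p a8])
  obtain e where e: "cj a (rot 8) = rot e"
    using conj_rot_in_D[OF a a8] rot_small[of 4] p by auto
  obtain x where x: "cj w (rot 1) = rot x"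
    using conj_rot_in_D[OF w_closed w1] rot_small[of 1] p by auto
  define S y where "S = cj a (rot 2)" and "y = cj z (rot 1)"
  have [simp]: "S \<in> carrier G" "y \<in> carrier G" by (simp_all add: S_def y_def)
  have S: "S = y \<otimes> rot 1" by (simp add: S_def y_def cj_a_rot_2)
  define m where "m = - x"
  have "rot (- 8) = rot (x * 8)"
    using cj_w_inverts[OF e] cj_rot_mult[OF w_closed x, of 8] by simp
  moreover have m8: "2 ^ 3 * (m - 1) = - 8 - x * 8" by (simp add: m_def)
  ultimately have "2 ^ p dvd 2 ^ 3 * (m - 1)" unfolding rot_eq_iff m8 by blast
  then have m2: "2 ^ 2 dvd m - 1" by (rule small_dvd) (use p in simp)
  have "cj S (rot (- 1)) = rot x" using x by (simp add: cj_w_rot S_def)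
  from cj_rot_minus[OF _ this] have Sm: "cj S (rot 1) = rot m" by (simp add: m_def)
  have "cj S (rot k) = rot (m * k)" for k
    using cj_rot_mult[OF _ Sm, of k] by simp
  then have "cj (S \<otimes> S \<otimes> (S \<otimes> S)) (rot 1) = rot (m ^ 4)"
    by (simp add: conj_by_conj_by power4_eq_xxxx mult.assoc)
  moreover have "S \<otimes> S \<otimes> (S \<otimes> S) = rot e"
    using e by (simp add: S_def rot_add flip: conj_by_mult)
  moreover have "cj (rot e) (rot 1) = rot 1" by (simp add: conj_by_eq_iff rot_add add.commute)
  ultimately have "2 ^ p dvd m ^ 4 - 1" by (simp add: rot_eq_iff dvd_diff_commute)
  then have m4: "2 ^ 5 dvd m ^ 4 - 1" using p le_imp_power_dvd dvd_trans by blast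
  obtain j where j: "m = 1 + 4 * j" 
    using m2 by (metis dvdE add_diff_cancel_left' diff_add_cancel add.commute power2_eq_square
        mult_2 numeral_Bit0 numeral_One one_add_one)
  have "m ^ 4 - 1 = 16 * j + 32 * (3 * j ^ 2 + 8 * j ^ 3 + 8 * j ^ 4)"
    by (simp add: j power4_eq_xxxx power3_eq_cube power2_eq_square algebra_simps)
  then have "32 dvd 16 * j" using m4 by (simp add: dvd_add_left_iff)
  then have "even j" by presburger
  then obtain k where k: "1 - m = 8 * k" using j by (auto elim!: evenE intro: that[of "- _"])
  define T where "T = rot 1 \<otimes> y"
  have "T = rot 1 \<otimes> (S \<otimes> rot (- 1))" by (simp add: T_def S m_assoc rot_add)
  also have "S \<otimes> rot (- 1) = rot (- m) \<otimes> S"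
    using cj_rot_minus[OF _ Sm] by (simp add: conj_by_eq_iff)
  finally have T: "T = rot (8 * k) \<otimes> S" by (simp add: rot_add' k)
  have "cj z (rot 2) = cj a T" by (simp add: cj_z_rot_2' T_def y_def)
  also have "\<dots> = rot (e * k) \<otimes> rot 2"
    unfolding T using cj_rot_mult[OF a e, of k]
    by (simp add: conj_by_mult S_def conj_by_twice)
  finally show "cj z (rot 2) \<in> D" by (simp add: rot_add)
qed

end

section \<open>Groups of 2-power order\<close>

context involution_triple_2
begin

lemma card_D:
  assumes "p \<ge> 2" shows "card D = 2 ^ Suc p" "finite D"
proof -
  have one: "rot (2 ^ p) = \<one>" by (simp add: rot_eq_one)
  then show "finite D" using card_D_le(1)[of "2 ^ p"] by simp
  have "card D \<le> 2 ^ Suc p"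
    using card_D_le(2)[of "2 ^ p"] one by (simp add: nat_power_eq)
  moreover have "2 ^ Suc p \<le> card D"
  proof -
    let ?R = "rot ` {0..<2 ^ p}"
    have "inj_on rot {0..<2 ^ p}"
    proof (rule inj_onI)
      fix i j :: int assume ij: "i \<in> {0..<2 ^ p}" "j \<in> {0..<2 ^ p}" "rot i = rot j"
      then have "i mod 2 ^ p = j mod 2 ^ p" using mod_eq_dvd_iff rot_eq_iff by metis
      moreover have "i mod 2 ^ p = i" "j mod 2 ^ p = j" using ij by simp_all
      ultimately show "i = j" by metis
    qed
    then have R: "card ?R = 2 ^ p" by (simp add: card_image nat_power_eq)
    have "inj_on (\<lambda>x. x \<otimes> c) ?R" by (rule inj_onI) auto
    then have Rc: "card ((\<lambda>x. x \<otimes> c) ` ?R) = 2 ^ p" using R by (simp add: card_image)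
    \<comment> \<open>If some reflection were a rotation, then \<open>c\<close> would commute with
      \<open>r\<close>, which it inverts; \<open>p \<ge> 2\<close> excludes
      \<open>r^2 = 1\<close>.\<close>
    have False if eq: "rot i = rot j \<otimes> c" for i j
    proof -
      have "c = rot (i - j)"
        using inv_solve_left[of c "rot j" "rot i"] eq unfolding inv_rot rot_add by simp
      then have "c \<otimes> rot 1 = rot 1 \<otimes> c" by (metis rot_add add.commute)
      then have "rot (- 1) = rot 1" unfolding c_rot by simp
      then have "2 ^ p dvd (- 2 :: int)" by (simp add: rot_eq_iff)
      moreover have "(2::int) ^ 2 dvd 2 ^ p" using assms by (rule le_imp_power_dvd)
      ultimately have "(2::int) ^ 2 dvd - 2" using dvd_trans by blast
      then show False by simp
    qed
    then have "?R \<inter> (\<lambda>x. x \<otimes> c) ` ?R = {}" by blast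
    then have "card (?R \<union> (\<lambda>x. x \<otimes> c) ` ?R) = 2 ^ Suc p"
      using R Rc by (subst card_Un_disjoint) simp_all
    moreover have "?R \<union> (\<lambda>x. x \<otimes> c) ` ?R \<subseteq> D" by (auto simp: rot_c_in_D)
    ultimately show ?thesis using \<open>finite D\<close> card_mono by metis
  qed
  ultimately show "card D = 2 ^ Suc p" by simp
qed

lemma conj_rot_mem:
  assumes "subgroup K G" "finite K" "D \<subseteq> K" "card K \<le> 2 ^ Suc j * card D" "x \<in> K"
  shows "cj x (rot (2 ^ j)) \<in> D"
proof -
  have "b \<otimes> c \<in> D" using rot_in_D[of 1] by (simp add: rot_1)
  then show ?thesis
    using conj_pow_mem[OF subgroup_D assms(1-4) _ _ assms(5), of "b \<otimes> c" p] rot_eq_one[of "2 ^ p"]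
    by (simp add: rot_def)
qed

lemma conj_a_rot_mem:
  assumes "order G = 2 ^ Suc j * card D"
  shows "cj a (rot (2 ^ j)) \<in> D"
proof (cases "finite (carrier G)")
  case True
  then show ?thesis
    using assms conj_rot_mem[OF subgroup_self _ D_sub, of j a] by (simp add: order_def)
next
  case False
  \<comment> \<open>An infinite group has \<open>order\<close> 0, while the right-hand side of the
    assumption is positive once \<open>D\<close> is finite.\<close>
  then have "finite D \<Longrightarrow> False" 
    using assms False subgroup.one_closed[OF subgroup_D] by (auto simp: order_def)
  moreover have "finite D" using card_D_le(1)[of "2 ^ p"] rot_eq_one by simp
  ultimately show ?thesis by blast
qed

text \<open>Although \<open>a\<close> stays outside \<open>M\<close>, it normalises
  \<open>M\<close>. This brings \<open>a b a\<close> into \<open>M\<close>, and with it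
  \<open>z = (a b a) b\<close>.\<close>

lemma index_2_subgroup_without_a:
  assumes "order G = 2 ^ n" "D \<noteq> carrier G"
  obtains M where "subgroup M G" "D \<subseteq> M" "a \<notin> M" "2 * card M = order G"
    "a \<otimes> (b \<otimes> a) \<in> M" "z \<in> M"
proof -
  have gen: "generate G (insert a D) = carrier G"
  proof
    show "generate G (insert a D) \<subseteq> carrier G"
      using D_sub by (intro generate_incl) auto
    have "generate G {a, b, c} \<subseteq> generate G (insert a D)"
      by (rule mono_generate) auto
    then show "carrier G \<subseteq> generate G (insert a D)" using generated by simp
  qed
  have "a \<notin> D"
  proof
    assume "a \<in> D"
    then have "generate G {a, b, c} \<subseteq> D" by (intro generate_subgroup_incl subgroup_D) auto
    then show False using generated assms(2) D_sub by auto
  qed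
  from index_2_subgroup_of_2_group[OF subgroup_D a aa this gen assms(1)]
  obtain M where M: "subgroup M G" "D \<subseteq> M" "a \<notin> M" "2 * card M = order G"
    "\<forall>m\<in>M. cj a m \<in> M" by blast
  have "b \<in> M" using M(2) by auto
  then have d: "a \<otimes> (b \<otimes> a) \<in> M"
    using bspec[OF M(5), of b] by (simp add: conj_by_def m_assoc)
  then have "a \<otimes> (b \<otimes> a) \<otimes> b \<in> M" using M(1) \<open>b \<in> M\<close> by (simp add: subgroup.m_closed)
  then have "z \<in> M" by (simp add: z_def m_assoc)
  then show ?thesis using M d that by blast
qed

lemma commutator_of_index_4:
  assumes "p \<ge> 3" "order G = 2 ^ (p + 3)"
  shows "commutator G z c = \<one> \<or> commutator G z c = rot (2 ^ (p - 1))"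
  using conj_a_rot_mem[of 1] assms card_D by (intro commutator_z_c_cases) (simp_all add: power_add)

lemma commutator_of_index_8:
  assumes p: "p \<ge> 4" and ord: "order G = 2 ^ (p + 4)"
  shows "commutator G z (rot 2) = \<one> \<or> commutator G z (rot 2) = rot (2 ^ (p - 1))"
proof (rule commutator_z_rot_cases[OF p])
  show "cj a (rot 4) \<in> D"
    using conj_a_rot_mem[of 2] card_D assms by (simp add: power_add)
  have fin: "finite (carrier G)" using ord order_gt_0_iff_finite by simp
  have "D \<noteq> carrier G" using card_D p ord by (auto simp: order_def power_add)
  then obtain M where M: "subgroup M G" "D \<subseteq> M" "2 * card M = order G" "z \<in> M"
    using index_2_subgroup_without_a[OF ord] by metis
  have "finite M" using M fin subgroup.subset finite_subset by metis
  then show "cj z (rot 2) \<in> D"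
    using conj_rot_mem[OF M(1) _ M(2) _ M(4), of 1] M(3) card_D p ord by (simp add: power_add)
qed

lemma commutator_of_index_16:
  assumes p: "p \<ge> 5" and ord: "order G = 2 ^ (p + 5)"
  shows "\<exists>k l. commutator G a (rot 2) \<otimes> commutator G a (rot 2) = rot k \<and>
           commutator G a (rot 4) = rot l \<and> 2 ^ p dvd 2 * k \<and> 2 ^ p dvd 2 * l"
proof -
  have fin: "finite (carrier G)" using ord order_gt_0_iff_finite by simp
  have cD: "card D = 2 * 2 ^ p" "finite D" using card_D p by simp_all
  have a8: "cj a (rot 8) \<in> D"
    using conj_a_rot_mem[of 3] cD ord by (simp add: power_add)
  have "D \<noteq> carrier G" using cD ord by (auto simp: order_def power_add)
  define d where "d = a \<otimes> (b \<otimes> a)"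
  have d [simp]: "d \<in> carrier G" by (simp add: d_def)
  have dd: "d \<otimes> d = \<one>" by (simp add: d_def m_assoc)
  obtain M where M: "subgroup M G" "D \<subseteq> M" "a \<notin> M" "2 * card M = order G" "d \<in> M" "z \<in> M"
    using index_2_subgroup_without_a[OF ord \<open>D \<noteq> carrier G\<close>] unfolding d_def by metis
  have MG: "M \<subseteq> carrier G" using M(1) subgroup.subset by blast
  then have finM: "finite M" using fin finite_subset by blast
  have cM: "card M = 8 * card D" using M(4) ord cD by (simp add: power_add)
  have z4: "cj z (rot 4) \<in> D"
    using conj_rot_mem[OF M(1) finM M(2) _ M(6), of 2] cM by simp
  let ?M = "G\<lparr>carrier := M\<rparr>"
  \<comment> \<open>The index-2 lemma is to be applied inside \<open>M\<close> with
    \<open>d = a b a\<close> as the excluded involution, so \<open>M\<close> must be generated by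
    \<open>d\<close> and \<open>D\<close>. The subgroup generated by them has at most the two cosets
    \<open>?L\<close> and \<open>a ?L\<close>, because \<open>b a = a d\<close> and
    \<open>c a = a c\<close>; by cardinality it is \<open>M\<close>.\<close>
  let ?L = "generate G (insert d D)"
  have DG: "insert d D \<subseteq> carrier G" using D_sub by auto
  have L: "subgroup ?L G" by (rule generate_is_subgroup[OF DG])
  have "?L \<subseteq> M" using M by (intro generate_subgroup_incl) auto
  then have finL: "finite ?L" using finM finite_subset by blast
  have inL: "x \<in> ?L" if "x \<in> insert d D" for x using that by (rule generate.incl)
  have "card (carrier G) \<le> card {?L, A ?L} * card ?L"
  proof (rule conjunct2[OF card_le_of_closed_cosets[OF L finL generated]])
    have BA: "B (A ?L) = A ?L"
    proof -
      have "B (A ?L) = A (coset_act G d ?L)" by (simp add: d_def coset_act_mult)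
      then show ?thesis using L inL by simp
    qed
    have CA: "C (A ?L) = A ?L"
      using act_ca[of ?L] L inL by simp
    show "\<And>s p. s \<in> {a, b, c} \<Longrightarrow> p \<in> {?L, A ?L} \<Longrightarrow> coset_act G s p \<in> {?L, A ?L}"
      using BA CA L inL by auto
  qed auto
  also have "\<dots> \<le> 2 * card ?L"
    using card_insert_le_m1[of 2 "{A ?L}" ?L] by (intro mult_right_mono) auto
  finally have "card M \<le> card ?L" using M(4) by (simp add: order_def)
  then have "?L = M" using \<open>?L \<subseteq> M\<close> finM card_seteq by blast
  then have gen: "generate ?M (insert d D) = carrier ?M"
    using generate_consistent[of "insert d D" M] M by simp
  have "d \<notin> D"
  proof
    assume "d \<in> D"
    then have "?L \<subseteq> D" using generate_subgroup_incl[OF _ subgroup_D] by simp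
    then have "card M \<le> card D" using \<open>?L = M\<close> cD card_mono by metis
    then show False using cM cD by simp
  qed
  interpret M: group ?M by (rule subgroup.subgroup_is_group[OF M(1) is_group])
  have ordM: "order ?M = 2 ^ (p + 4)" using cM cD by (simp add: order_def power_add)
  have subD: "subgroup D ?M" by (rule subgroup_incl[OF subgroup_D M(1,2)])
  have "\<exists>N. subgroup N ?M \<and> D \<subseteq> N \<and> d \<notin> N \<and> 2 * card N = order ?M \<and>
      (\<forall>m\<in>N. conj_by ?M d m \<in> N)"
    by (rule M.index_2_subgroup_of_2_group[OF subD _ _ \<open>d \<notin> D\<close> gen ordM]) (use M dd in simp_all)
  then obtain N where N: "subgroup N ?M" "D \<subseteq> N" "2 * card N = order ?M"
      "\<forall>m\<in>N. conj_by ?M d m \<in> N" by blast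
  have NG: "subgroup N G" by (rule incl_subgroup[OF M(1) N(1)])
  have cN: "card N = 4 * card D" using N(3) cM by (simp add: order_def)
  have finN: "finite N" using fin NG subgroup.subset finite_subset by metis
  have "w \<in> N"
  proof -
    have "c \<in> N" using N(2) by auto
    then have "conj_by ?M d c \<in> N" using N(4) by blast
    moreover have "inv\<^bsub>?M\<^esub> d = d"
      using m_inv_consistent[OF M(1,5)] dd inv_involution by simp
    ultimately have "d \<otimes> c \<otimes> d \<in> N" by (simp add: conj_by_def)
    also have "d \<otimes> c \<otimes> d = w" by (simp add: d_def w_def m_assoc ca')
    finally show ?thesis .
  qed
  have w2: "cj w (rot 2) \<in> D"
    using conj_rot_mem[OF NG finN N(2) _ \<open>w \<in> N\<close>, of 1] cN by simp
  \<comment> \<open>Otherwise \<open>q = w D\<close>, its images under \<open>b\<close> and \<open>c\<close>, a further image and \<open>D\<close> are five cosets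
    in \<open>N\<close>, which has only four.\<close>
  have "cj a (rot 4) \<in> D"
  proof (rule ccontr)
    assume a4: "cj a (rot 4) \<notin> D"
    have z2: "cj z (rot 2) \<notin> D" using conj_a_rot_4_of_conj_z[OF p a8] a4 by blast
    have w1: "cj w (rot 1) \<notin> D" using conj_a_rot_4_of_conj_w[OF p a8] a4 by blast
    define p2 p4 q where "p2 = A D" and "p4 = A (B p2)" and "q = coset_act G w D"
    have q: "q = A (B (C (B p2)))" by (simp add: q_def p2_def act_w)
    have q': "q = A (B (A (C p4)))" by (simp add: q p4_def act_ca)
    have c2: "C p2 = p2" by (simp add: p2_def act_ca)
    have b4: "B p4 = p4" using act_baba[of D] by (simp add: p4_def p2_def)
    \<comment> \<open>By \<open>(a b)^4 = 1\<close>, \<open>b\<close> fixes \<open>q\<close> exactly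
      if it fixes \<open>c p4\<close>, and then \<open>r^2\<close> would fix
      \<open>p4 = z D\<close>. Likewise, if \<open>c\<close> fixed \<open>q\<close>, it would fix
      \<open>b c b p2\<close>, and \<open>r^4\<close> would fix \<open>p2 = a D\<close>.\<close>
    have "B (C (B (C p4))) \<noteq> p4"
      using z2 act_fixes_iff[of "rot 2" z] by (simp add: act_z act_rot_2 p4_def p2_def)
    then have "B (C p4) \<noteq> C p4" using b4 by auto
    then have bq: "B q \<noteq> q"
      unfolding q' using act_baba[of "A (C p4)"] by (metis act_involutions)
    have "B (C (B (C (B (C (B (C p2))))))) \<noteq> p2"
      using a4 act_fixes_iff[of "rot 4" a] by (simp add: act_rot_4 p2_def)
    then have "C (B (C (B p2))) \<noteq> B (C (B p2))" using c2 by auto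
    then have cq: "C q \<noteq> q"
      unfolding q act_ca by (metis act_involutions)
    have rq: "B (C q) \<noteq> q"
      using w1 act_fixes_iff[of "rot 1" w] by (simp add: act_rot_1 q_def)
    have rrq: "B (C (B (C q))) = q"
      using w2 act_fixes_iff[of "rot 2" w] by (simp add: act_rot_2 q_def)
    have Dq: "q \<noteq> D" using rq by auto
    have "card {D, q, B q, C q, C (B q)} = 5"
    proof -
      have "C (B q) \<noteq> B q" using rrq cq by (metis act_involutions)
      moreover have "C (B q) \<noteq> q" "C q \<noteq> B q" using rq by (metis act_involutions)+
      moreover have "C (B q) \<noteq> C q" using bq by (metis act_involutions)
      moreover have "B q \<noteq> D" "C q \<noteq> D" "C (B q) \<noteq> D" using Dq by (metis act_D act_involutions)+
      ultimately show ?thesis using bq cq Dq by (simp add: eq_commute[of _ D] card_insert_if)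
    qed
    moreover have "{D, q, B q, C q, C (B q)} \<subseteq> (\<lambda>g. coset_act G g D) ` N"
    proof -
      have bcN: "b \<in> N" "c \<in> N" using N(2) by auto
      have "coset_act G \<one> D = D" "coset_act G w D = q" "coset_act G (b \<otimes> w) D = B q"
        "coset_act G (c \<otimes> w) D = C q" "coset_act G (c \<otimes> (b \<otimes> w)) D = C (B q)"
        by (simp_all add: q_def coset_act_mult)
      moreover have "\<one> \<in> N" "b \<otimes> w \<in> N" "c \<otimes> w \<in> N" "c \<otimes> (b \<otimes> w) \<in> N"
        using bcN \<open>w \<in> N\<close> NG by (auto intro: subgroup.m_closed subgroup.one_closed)
      ultimately show ?thesis using \<open>w \<in> N\<close> by (metis (no_types, lifting) image_eqI empty_subsetI insert_subset)
    qed
    ultimately have "5 * card D \<le> card N"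
      using card_cosets_le[OF subgroup_D NG finN N(2)] by metis
    then show False using cN cD by simp
  qed
  then show ?thesis using commutator_a_rot_cases p w2 by simp
qed

end

section \<open>Presentations\<close>

definition word_eval :: "('a, 'b) monoid_scheme \<Rightarrow> ('x \<Rightarrow> 'a) \<Rightarrow> ('x \<times> bool) list \<Rightarrow> 'a" where
  "word_eval G f w = foldr (\<lambda>l g. (if snd l then f (fst l) else inv\<^bsub>G\<^esub> f (fst l)) \<otimes>\<^bsub>G\<^esub> g) w \<one>\<^bsub>G\<^esub>"

context group
begin

lemma word_eval_simps [simp]:
  "word_eval G f [] = \<one>"
  "word_eval G f (l # w) = (if snd l then f (fst l) else inv f (fst l)) \<otimes> word_eval G f w"
  by (simp_all add: word_eval_def)

context
  fixes f :: "'x \<Rightarrow> 'a" and S :: "'x set"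
  assumes f: "f ` S \<subseteq> carrier G"
begin

lemma word_eval_closed: "w \<in> lists (S \<times> UNIV) \<Longrightarrow> word_eval G f w \<in> carrier G"
  by (induction w) (use f in auto)

lemma word_eval_append:
  "u \<in> lists (S \<times> UNIV) \<Longrightarrow> v \<in> lists (S \<times> UNIV) \<Longrightarrow>
   word_eval G f (u @ v) = word_eval G f u \<otimes> word_eval G f v"
proof (induction u)
  case (Cons l u)
  have "word_eval G f u \<in> carrier G" "word_eval G f v \<in> carrier G"
    using Cons.prems by (auto intro!: word_eval_closed)
  then show ?case
    using Cons f by (auto simp: m_assoc image_subset_iff)
qed (simp add: word_eval_closed)

lemma word_eval_cancel_Cons:
  assumes "l \<in> S \<times> UNIV" "w \<in> lists (S \<times> UNIV)"
  shows "word_eval G f (cancel_Cons l w) = word_eval G f (l # w)"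
proof (cases w)
  case (Cons k v)
  have v: "word_eval G f v \<in> carrier G"
    using assms Cons by (intro word_eval_closed) simp
  have "f (fst l) \<in> carrier G" using assms f by auto
  then show ?thesis
    using v Cons by (auto simp: flip_letter_def simp flip: m_assoc)
qed simp

lemma word_eval_free_reduce:
  "w \<in> lists (S \<times> UNIV) \<Longrightarrow> word_eval G f (free_reduce w) = word_eval G f w"
proof (induction w)
  case (Cons l w)
  have "free_reduce w \<in> lists (S \<times> UNIV)"
    unfolding free_reduce_def using Cons.prems by (intro foldr_cancel_Cons_lists) auto
  then show ?case
    using Cons word_eval_cancel_Cons[of l "free_reduce w"] by (simp add: free_reduce_def)
qed (simp add: free_reduce_def)

lemma word_eval_hom: "word_eval G f \<in> hom (free_group S) G"
  by (rule homI)
    (simp_all add: free_group_def word_eval_closed word_eval_free_reduce word_eval_append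
      del: in_lists_conv_set)

lemma word_eval_free_gen: "x \<in> S \<Longrightarrow> word_eval G f (free_gen x) = f x"
  using f by (auto simp: free_gen_def)

end

end

lemma free_gen_closed: "x \<in> S \<Longrightarrow> free_gen x \<in> carrier (free_group S)"
  by (simp add: free_group_def free_gen_def)

lemma inv_free_gen:
  assumes "x \<in> S" shows "inv\<^bsub>free_group S\<^esub> free_gen x = [(x, False)]"
  by (rule group.inv_equality[OF group_free_group])
    (use assms in \<open>simp_all add: free_group_def free_gen_def free_reduce_def flip_letter_def\<close>)

lemma generate_free_gen: "generate (free_group S) (free_gen ` S) = carrier (free_group S)"
proof
  show "generate (free_group S) (free_gen ` S) \<subseteq> carrier (free_group S)"
    by (rule group.generate_incl[OF group_free_group]) (auto intro: free_gen_closed)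
  have "w \<in> generate (free_group S) (free_gen ` S)"
    if "w \<in> lists (S \<times> UNIV)" "reduced_word w" for w
    using that
  proof (induction w rule: list.induct)
    case Nil
    then show ?case
      using generate.one[of "free_group S"] by (simp add: free_group_def)
  next
    case (Cons l w)
    have "reduced_word w" using Cons.prems(2) by auto
    then have w: "w \<in> generate (free_group S) (free_gen ` S)" using Cons by simp
    obtain x s where l: "l = (x, s)" "x \<in> S" using Cons.prems(1) by auto
    have "[l] \<in> generate (free_group S) (free_gen ` S)"
    proof (cases s)
      case True
      then have "[l] = free_gen x" using l by (simp add: free_gen_def)
      then show ?thesis using l by (auto intro: generate.incl)
    next
      case False
      then have "[l] = inv\<^bsub>free_group S\<^esub> free_gen x" using l by (simp add: inv_free_gen)
      then show ?thesis using l by (auto intro: generate.inv)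
    qed
    from generate.eng[OF this w] show ?case
      using free_reduce_reduced[OF Cons.prems(2)] by (simp add: free_group_def)
  qed
  then show "carrier (free_group S) \<subseteq> generate (free_group S) (free_gen ` S)"
    by (auto simp: free_group_def)
qed

lemma normal_normal_closure_free_group:
  "R \<subseteq> carrier (free_group S) \<Longrightarrow> normal_closure (free_group S) R \<lhd> free_group S"
  by (rule group.normal_closure_normal[OF group_free_group])

lemma presented_hom:
  assumes "R \<subseteq> carrier (free_group S)"
  shows "(\<lambda>w. normal_closure (free_group S) R #>\<^bsub>free_group S\<^esub> w)
           \<in> hom (free_group S) (presented_group S R)"
  unfolding presented_group_def
  by (rule normal.r_coset_hom_Mod[OF normal_normal_closure_free_group[OF assms]])

lemma presented_relator:
  assumes R: "R \<subseteq> carrier (free_group S)" and r: "r \<in> R"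
  shows "normal_closure (free_group S) R #>\<^bsub>free_group S\<^esub> r = \<one>\<^bsub>presented_group S R\<^esub>"
proof -
  let ?F = "free_group S"
  interpret F: group ?F by (rule group_free_group)
  have "r = \<one>\<^bsub>?F\<^esub> \<otimes>\<^bsub>?F\<^esub> r \<otimes>\<^bsub>?F\<^esub> inv\<^bsub>?F\<^esub> \<one>\<^bsub>?F\<^esub>" using R r by auto
  then have "r \<in> normal_closure ?F R"
    unfolding normal_closure_def using r by (intro generate.incl) blast
  then show ?thesis
    using normal_normal_closure_free_group[OF R, THEN normal_imp_subgroup] F.coset_join2 R r
    by (auto simp: presented_group_def FactGroup_def)
qed

lemma generate_presented_gen:
  assumes R: "R \<subseteq> carrier (free_group S)"
  shows "generate (presented_group S R) (presented_gen S R ` S) = carrier (presented_group S R)"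
proof -
  let ?F = "free_group S" and ?P = "presented_group S R"
  let ?\<pi> = "\<lambda>w. normal_closure ?F R #>\<^bsub>?F\<^esub> w"
  have "group_hom ?F ?P ?\<pi>"
    using group_free_group group_presented_group[OF R] presented_hom[OF R]
    by (simp add: group_hom_def group_hom_axioms_def)
  from group_hom.generate_img[OF this, of "free_gen ` S"]
  have "generate ?P (?\<pi> ` free_gen ` S) = ?\<pi> ` carrier ?F"
    using generate_free_gen[of S] by (auto intro: free_gen_closed)
  moreover have "?\<pi> ` free_gen ` S = presented_gen S R ` S"
    by (auto simp: presented_gen_def)
  moreover have "?\<pi> ` carrier ?F = carrier ?P"
    by (auto simp: presented_group_def FactGroup_def RCOSETS_def)
  ultimately show ?thesis by simp
qed

lemma iso_presentationD:
  assumes G: "group G" "\<rho> ` S \<subseteq> carrier G" and R: "R \<subseteq> carrier (free_group S)"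
    and iso: "iso_presentation G \<rho> S R"
  obtains h where "h \<in> hom (free_group S) G" "\<And>x. x \<in> S \<Longrightarrow> h (free_gen x) = \<rho> x"
    "\<And>r. r \<in> R \<Longrightarrow> h r = \<one>\<^bsub>G\<^esub>"
proof -
  obtain \<phi> where \<phi>: "\<phi> \<in> iso G (presented_group S R)" "\<forall>x\<in>S. \<phi> (\<rho> x) = presented_gen S R x"
    using iso by (auto simp: iso_presentation_def)
  let ?\<psi> = "inv_into (carrier G) \<phi>"
  have \<psi>: "?\<psi> \<in> hom (presented_group S R) G"
    using group.iso_set_sym[OF G(1) \<phi>(1)] by (simp add: iso_def)
  have inj: "inj_on \<phi> (carrier G)" using \<phi>(1) by (simp add: iso_def bij_betw_def)
  let ?h = "\<lambda>w. ?\<psi> (normal_closure (free_group S) R #>\<^bsub>free_group S\<^esub> w)"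
  show ?thesis
  proof (rule that[of ?h])
    show "?h \<in> hom (free_group S) G"
      using hom_compose[OF presented_hom[OF R] \<psi>] by (simp add: o_def)
    show "?h (free_gen x) = \<rho> x" if "x \<in> S" for x
    proof -
      have "\<rho> x \<in> carrier G" using that G(2) by auto
      then show ?thesis using \<phi>(2) that inv_into_f_f[OF inj] by (metis presented_gen_def)
    qed
    show "?h r = \<one>\<^bsub>G\<^esub>" if "r \<in> R" for r
      using presented_relator[OF R that] hom_one[OF \<psi> group_presented_group[OF R] G(1)] by simp
  qed
qed

text \<open>\<open>h\<close> factors through the presented group, and the induced map is onto
  because it hits the generators. The bound on the order then makes it injective.\<close>

lemma iso_presentationI:
  assumes G: "group G" "\<rho> ` S \<subseteq> carrier G" "generate G (\<rho> ` S) = carrier G" "finite (carrier G)"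
    and R: "R \<subseteq> carrier (free_group S)"
    and h: "h \<in> hom (free_group S) G" "\<And>x. x \<in> S \<Longrightarrow> h (free_gen x) = \<rho> x"
      "\<And>r. r \<in> R \<Longrightarrow> h r = \<one>\<^bsub>G\<^esub>"
    and P: "finite (carrier (presented_group S R))" "order (presented_group S R) \<le> order G"
  shows "iso_presentation G \<rho> S R"
proof -
  let ?F = "free_group S" and ?P = "presented_group S R"
  let ?N = "normal_closure ?F R"
  interpret F: group ?F by (rule group_free_group)
  interpret P: group ?P by (rule group_presented_group[OF R])
  interpret G: group G by (rule G)
  interpret h: group_hom ?F G h by unfold_locales (rule h(1))
  have N: "?N \<lhd> ?F" by (rule normal_normal_closure_free_group[OF R])
  have "?N \<subseteq> kernel ?F G h"
    unfolding normal_closure_def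
  proof (rule F.generate_subgroup_incl[OF _ h.subgroup_kernel])
    show "{g \<otimes>\<^bsub>?F\<^esub> r \<otimes>\<^bsub>?F\<^esub> inv\<^bsub>?F\<^esub> g | g r. g \<in> carrier ?F \<and> r \<in> R} \<subseteq> kernel ?F G h"
    proof clarify
      fix g r assume "g \<in> carrier ?F" "r \<in> R"
      then show "g \<otimes>\<^bsub>?F\<^esub> r \<otimes>\<^bsub>?F\<^esub> inv\<^bsub>?F\<^esub> g \<in> kernel ?F G h"
        using R h(3)[of r] by (auto simp: kernel_def subset_iff)
    qed
  qed
  from h.FactGroup_universal_kernel[OF N this]
  obtain \<theta> where \<theta>: "\<theta> \<in> hom ?P G" "\<And>w. w \<in> carrier ?F \<Longrightarrow> \<theta> (?N #>\<^bsub>?F\<^esub> w) = h w"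
    unfolding presented_group_def by blast
  have gen: "\<theta> (presented_gen S R x) = \<rho> x" if "x \<in> S" for x
    using that \<theta>(2) h(2) by (simp add: presented_gen_def free_gen_closed)
  interpret \<theta>: group_hom ?P G \<theta> by unfold_locales (rule \<theta>(1))
  have pc: "presented_gen S R x \<in> carrier ?P" if "x \<in> S" for x
    using generate_presented_gen[OF R] that generate.incl by (metis imageI)
  have "\<theta> ` carrier ?P = generate G (\<theta> ` presented_gen S R ` S)"
    using \<theta>.generate_img[of "presented_gen S R ` S"] pc generate_presented_gen[OF R] by auto
  also have "\<theta> ` presented_gen S R ` S = \<rho> ` S" using gen by (auto simp: image_iff)
  finally have surj: "\<theta> ` carrier ?P = carrier G" using G(3) by simp
  have "inj_on \<theta> (carrier ?P)"
  proof (rule eq_card_imp_inj_on[OF P(1)])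
    show "card (\<theta> ` carrier ?P) = card (carrier ?P)"
      using surj P card_image_le[OF P(1), of \<theta>] by (simp add: order_def)
  qed
  then have iso: "\<theta> \<in> iso ?P G" using \<theta>(1) surj by (simp add: iso_def bij_betw_def)
  show ?thesis
    unfolding iso_presentation_def
  proof (intro bexI ballI)
    show "inv_into (carrier ?P) \<theta> \<in> iso G ?P" by (rule P.iso_set_sym[OF iso])
    show "inv_into (carrier ?P) \<theta> (\<rho> x) = presented_gen S R x" if "x \<in> S" for x
      using inv_into_f_f[OF \<open>inj_on \<theta> (carrier ?P)\<close> pc[OF that]] gen[OF that] by simp
  qed
qed

section \<open>Relators and their images under homomorphisms\<close>

lemma (in group) commutator_closed [simp]:
  "x \<in> carrier G \<Longrightarrow> y \<in> carrier G \<Longrightarrow> commutator G x y \<in> carrier G"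
  by (simp add: commutator_def)

lemma (in group_hom) hom_commutator:
  "x \<in> carrier G \<Longrightarrow> y \<in> carrier G \<Longrightarrow> h (commutator G x y) = commutator H (h x) (h y)"
  by (simp add: commutator_def)

lemmas relators_defs = relators1_def relators2_def relators3_def relators4_def
  relators5_def relators6_def relators7_def relators8_def relators_base_def

context group
begin

lemma relators_closed:
  assumes "\<rho> 0 \<in> carrier G" "\<rho> 1 \<in> carrier G" "\<rho> 2 \<in> carrier G"
  shows "relators1 G \<rho> n \<subseteq> carrier G" "relators2 G \<rho> n \<subseteq> carrier G"
    "relators3 G \<rho> n \<subseteq> carrier G" "relators4 G \<rho> n \<subseteq> carrier G"
    "relators5 G \<rho> n \<subseteq> carrier G" "relators6 G \<rho> n \<subseteq> carrier G"
    "relators7 G \<rho> n \<subseteq> carrier G" "relators8 G \<rho> n \<subseteq> carrier G"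
  using assms by (auto simp: relators_defs)

end

context group_hom
begin

lemma image_relators:
  assumes [simp]: "\<rho> 0 \<in> carrier G" "\<rho> 1 \<in> carrier G" "\<rho> 2 \<in> carrier G"
    and [simp]: "h (\<rho> 0) = \<sigma> 0" "h (\<rho> 1) = \<sigma> 1" "h (\<rho> 2) = \<sigma> 2"
  shows "h ` relators1 G \<rho> n = relators1 H \<sigma> n" "h ` relators2 G \<rho> n = relators2 H \<sigma> n"
    "h ` relators3 G \<rho> n = relators3 H \<sigma> n" "h ` relators4 G \<rho> n = relators4 H \<sigma> n"
    "h ` relators5 G \<rho> n = relators5 H \<sigma> n" "h ` relators6 G \<rho> n = relators6 H \<sigma> n"
    "h ` relators7 G \<rho> n = relators7 H \<sigma> n" "h ` relators8 G \<rho> n = relators8 H \<sigma> n"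
  by (simp_all only: relators_defs image_Un image_insert image_empty)
    (simp_all add: hom_commutator hom_nat_pow del: One_nat_def)

end

section \<open>Orders of \<open>a b\<close> and \<open>b c\<close> recovered from the order of the
  group\<close>

context involution_triple
begin

lemma ab_squared: "(a \<otimes> b) [^] (2::nat) = z"
  by (simp add: numeral_2_eq_2 z_def m_assoc)

lemma bc_pow: "(b \<otimes> c) [^] (k::nat) = rot (int k)"
  by (simp add: rot_def int_pow_int)

text \<open>This is what excludes that \<open>a b\<close> has order less than 4.\<close>

lemma card_le_2_cosets:
  assumes "z = \<one>" "finite D"
  shows "card (carrier G) \<le> 2 * card D"
proof -
  have "A (B (A (B D))) = D" using act_z[of D] assms(1) by simp
  then have "B (A D) = A D" by (metis act_D(1) act_involutions(1,2))
  then show ?thesis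
    using card_le_of_closed_list(2)[of "[D, A D]"] assms(2) by (simp add: act_ca)
qed

lemma card_D_le_pow:
  assumes "rot (2 ^ m) = \<one>" shows "finite D" "card D \<le> 2 ^ Suc m"
  using card_D_le[of "2 ^ m"] assms by (simp_all add: nat_power_eq)

lemma order_le_mult_D:
  assumes "rot (2 ^ m) = \<one>" "finite (carrier G)" "card (carrier G) \<le> 2 ^ k * card D"
  shows "finite (carrier G) \<and> order G \<le> 2 ^ (m + Suc k)"
proof -
  have "2 ^ k * card D \<le> 2 ^ k * 2 ^ Suc m"
    by (intro mult_left_mono card_D_le_pow(2)[OF assms(1)]) simp
  also have "\<dots> = 2 ^ (m + Suc k)" by (simp add: power_add)
  finally show ?thesis using assms by (simp add: order_def)
qed

text \<open>A smaller order \<open>2 ^ m\<close> of \<open>b c\<close> would make the group too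
  small by \<open>bound\<close>. If the order of \<open>a b\<close> were a proper divisor of 4, then
  \<open>z = \<one>\<close> and the group would have at most \<open>2 * 2 ^ (s + 1)\<close>
  elements, fewer than \<open>2 ^ (s + i)\<close> for \<open>i \<ge> 3\<close>.\<close>

lemma ord_of_order:
  assumes s: "rot (2 ^ s) = \<one>" and i: "i \<ge> 3" and ord: "order G = 2 ^ (s + i)"
    and bound: "\<And>m. rot (2 ^ m) = \<one> \<Longrightarrow> order G \<le> 2 ^ (m + i)"
  shows "group.ord G (a \<otimes> b) = 4" "group.ord G (b \<otimes> c) = 2 ^ s"
proof -
  have "local.ord (b \<otimes> c) dvd 2 ^ s"
    using s bc_pow[of "2 ^ s"] by (intro pow_eq_id[THEN iffD1]) simp_all
  then obtain m where m: "m \<le> s" "local.ord (b \<otimes> c) = 2 ^ m"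
    using divides_primepow_nat two_is_prime_nat by blast
  have "rot (2 ^ m) = \<one>"
    using pow_ord_eq_1[of "b \<otimes> c"] bc_pow[of "2 ^ m"] m(2) by simp
  from bound[OF this] have "s + i \<le> m + i"
    unfolding ord by (rule power_le_imp_le_exp[rotated]) simp
  then show "local.ord (b \<otimes> c) = 2 ^ s" using m by simp
  have "(a \<otimes> b) [^] (4::nat) = z \<otimes> z"
    unfolding ab_squared[symmetric] by (subst nat_pow_mult) simp_all
  then have "local.ord (a \<otimes> b) dvd 2 ^ 2" by (simp add: pow_eq_id)
  then obtain j where j: "j \<le> 2" "local.ord (a \<otimes> b) = 2 ^ j"
    using divides_primepow_nat two_is_prime_nat by blast
  have "j = 2"
  proof (rule ccontr)
    assume "j \<noteq> 2"
    then have "2 ^ j dvd (2::nat)" using j(1) le_imp_power_dvd[of j 1 "2::nat"] by simp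
    then have "z = \<one>" using pow_eq_id[of "a \<otimes> b" 2] j(2) by (simp add: ab_squared)
    then have "order G \<le> 2 * card D"
      using card_le_2_cosets card_D_le_pow(1)[OF s] by (simp add: order_def)
    also have "\<dots> \<le> 2 ^ (s + 2)" using card_D_le_pow(2)[OF s] by simp
    also have "\<dots> < 2 ^ (s + i)" using i by (intro power_strict_increasing) simp_all
    finally show False using ord by simp
  qed
  then show "local.ord (a \<otimes> b) = 4" using j by simp
qed

end

lemma (in group) pow_2: "x \<in> carrier G \<Longrightarrow> x [^] (2::nat) = x \<otimes> x"
  by (simp add: numeral_2_eq_2)

lemma (in group) involution_tripleI:
  assumes [simp]: "a \<in> carrier G" "b \<in> carrier G" "c \<in> carrier G"
    and sq: "a [^] (2::nat) = \<one>" "b [^] (2::nat) = \<one>" "c [^] (2::nat) = \<one>"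
    and ab: "(a \<otimes> b) [^] (4::nat) = \<one>" and ac: "(a \<otimes> c) [^] (2::nat) = \<one>"
    and gen: "generate G {a, b, c} = carrier G"
  shows "involution_triple G a b c"
proof
  show aa: "a \<otimes> a = \<one>" and bb: "b \<otimes> b = \<one>" and cc: "c \<otimes> c = \<one>"
    using sq by (simp_all add: numeral_2_eq_2)
  have "inv (a \<otimes> c) = a \<otimes> c"
    using ac by (intro inv_involution) (simp_all add: numeral_2_eq_2)
  then show "c \<otimes> a = a \<otimes> c"
    using aa cc by (simp add: inv_mult_group inv_involution)
  have "(a \<otimes> b) [^] (4::nat) = (a \<otimes> b) [^] (2::nat) \<otimes> (a \<otimes> b) [^] (2::nat)"
    by (subst nat_pow_mult) simp_all
  then have "inv ((a \<otimes> b) [^] (2::nat)) = (a \<otimes> b) [^] (2::nat)"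
    using ab by (intro inv_involution) simp_all
  then show "b \<otimes> (a \<otimes> (b \<otimes> a)) = a \<otimes> (b \<otimes> (a \<otimes> b))"
    using aa bb by (simp add: numeral_2_eq_2 inv_mult_group inv_involution m_assoc)
qed (use gen in simp_all)

text \<open>The bound is required for every \<open>m\<close>, not only for \<open>s\<close>: in a group of order \<open>2 ^ (s + i)\<close> it
  then rules out that \<open>\<rho> 1 \<rho> 2\<close> has smaller order than the relator prescribes.\<close>

definition bounded_rank_3 :: "('a, 'b) monoid_scheme \<Rightarrow> (nat \<Rightarrow> 'a) \<Rightarrow> nat \<Rightarrow> nat \<Rightarrow> bool" where
  "bounded_rank_3 G \<rho> s i \<longleftrightarrow>
     involution_triple G (\<rho> 0) (\<rho> 1) (\<rho> 2) \<and> (\<rho> 1 \<otimes>\<^bsub>G\<^esub> \<rho> 2) [^]\<^bsub>G\<^esub> (2 ^ s :: nat) = \<one>\<^bsub>G\<^esub> \<and>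
     (\<forall>m. (\<rho> 1 \<otimes>\<^bsub>G\<^esub> \<rho> 2) [^]\<^bsub>G\<^esub> (2 ^ m :: nat) = \<one>\<^bsub>G\<^esub> \<longrightarrow>
        finite (carrier G) \<and> order G \<le> 2 ^ (m + i))"

lemma schlafli_type_of_bounded_rank_3:
  assumes "bounded_rank_3 G \<rho> s i" "i \<ge> 3" "order G = 2 ^ (s + i)"
  shows "schlafli_type G \<rho> = (4, 2 ^ s)"
proof -
  interpret involution_triple G "\<rho> 0" "\<rho> 1" "\<rho> 2"
    using assms(1) by (simp add: bounded_rank_3_def)
  have pow: "(\<rho> 1 \<otimes>\<^bsub>G\<^esub> \<rho> 2) [^]\<^bsub>G\<^esub> (2 ^ m :: nat) = rot (2 ^ m)" for m
    using bc_pow[of "2 ^ m"] by simp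
  show ?thesis
    unfolding schlafli_type_def
    using ord_of_order[of s i] assms by (simp add: bounded_rank_3_def pow del: One_nat_def)
qed

section \<open>Order bounds from the eight sets of relators\<close>

context group
begin

context
  fixes \<rho> :: "nat \<Rightarrow> 'a"
  assumes closed: "\<rho> ` {0, 1, 2} \<subseteq> carrier G" and gen: "generate G (\<rho> ` {0, 1, 2}) = carrier G"
begin

lemma relators_base_triple:
  assumes "relators_base G \<rho> q \<subseteq> {\<one>}"
  shows "involution_triple G (\<rho> 0) (\<rho> 1) (\<rho> 2)"
  using assms closed gen
  by (intro involution_tripleI) (simp_all add: relators_base_def del: One_nat_def)

lemma bounded_relators_4:
  assumes "relators1 G \<rho> n \<subseteq> {\<one>} \<or> relators2 G \<rho> n \<subseteq> {\<one>}"
  shows "bounded_rank_3 G \<rho> (n - 3) 3"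
proof -
  have base: "relators_base G \<rho> (2 ^ (n - 3)) \<subseteq> {\<one>}"
    using assms by (auto simp: relators1_def relators2_def)
  interpret involution_triple G "\<rho> 0" "\<rho> 1" "\<rho> 2" by (rule relators_base_triple[OF base])
  have pow: "(\<rho> 1 \<otimes> \<rho> 2) [^] (2 ^ m :: nat) = rot (2 ^ m)" for m
    using bc_pow[of "2 ^ m"] by simp
  have "commutator G z (\<rho> 2) = rot 0 \<or> commutator G z (\<rho> 2) \<otimes> rot (2 ^ (n - 4)) = rot 0"
    using assms by (auto simp: relators1_def relators2_def ab_squared pow simp del: One_nat_def)
  then obtain k where "commutator G z (\<rho> 2) = rot k" by (auto simp: rot_right_cancel simp del: One_nat_def rot_0)
  then have "finite (carrier G) \<and> order G \<le> 2 ^ (m + 3)" if "rot (2 ^ m) = \<one>" for m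
    using card_le_of_commutator_z_c[of k] card_D_le_pow(1)[OF that]
      order_le_mult_D[OF that, of 2] by simp
  then show ?thesis
    using base involution_triple_axioms
    by (simp add: bounded_rank_3_def pow relators_base_def del: One_nat_def)
qed

lemma bounded_relators_8:
  assumes n: "n \<ge> 10" and rel: "relators3 G \<rho> n \<subseteq> {\<one>} \<or> relators4 G \<rho> n \<subseteq> {\<one>}"
  shows "bounded_rank_3 G \<rho> (n - 4) 4"
proof -
  have base: "relators_base G \<rho> (2 ^ (n - 4)) \<subseteq> {\<one>}"
    using rel by (auto simp: relators3_def relators4_def)
  interpret involution_triple G "\<rho> 0" "\<rho> 1" "\<rho> 2" by (rule relators_base_triple[OF base])
  have pow: "(\<rho> 1 \<otimes> \<rho> 2) [^] (2 ^ m :: nat) = rot (2 ^ m)" for m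
    using bc_pow[of "2 ^ m"] by simp
  have pow2: "(\<rho> 1 \<otimes> \<rho> 2) [^] (2::nat) = rot 2"
    using bc_pow[of 2] by simp
  have one: "rot (2 ^ (n - 4)) = \<one>"
    using base by (simp add: relators_base_def pow del: One_nat_def)
  have "commutator G z (rot 2) = rot 0 \<or> commutator G z (rot 2) \<otimes> rot (2 ^ (n - 5)) = rot 0"
    using rel by (auto simp: relators3_def relators4_def ab_squared pow pow2 simp del: One_nat_def)
  then have com: "commutator G z (rot 2) = rot 0 \<or> commutator G z (rot 2) = rot (- (2 ^ (n - 5)))"
    by (auto simp: rot_right_cancel simp del: One_nat_def rot_0)
  have e: "2 * 2 ^ (n - 5) = (2::int) ^ (n - 4)"
  proof -
    have "n - 4 = Suc (n - 5)" using n by simp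
    then show ?thesis by simp
  qed
  have "8 dvd (2::int) ^ (n - 5)"
    using le_imp_power_dvd[of 3 "n - 5" "2::int"] n by simp
  moreover have "rot (2 * - (2 ^ (n - 5))) = \<one>"
    using one inv_rot[of "2 ^ (n - 4)"] e by simp
  ultimately obtain k where k: "commutator G z (rot 2) = rot k" "rot (2 * k) = \<one>" "8 dvd k"
    using com that by (metis dvd_0_right dvd_minus_iff mult_zero_right rot_0)
  then have "finite (carrier G) \<and> order G \<le> 2 ^ (m + 4)" if "rot (2 ^ m) = \<one>" for m
    using card_le_of_commutator_z_rot[of k] card_D_le_pow(1)[OF that]
      order_le_mult_D[OF that, of 3] by simp
  then show ?thesis
    using one involution_triple_axioms
    by (simp add: bounded_rank_3_def pow del: One_nat_def)
qed

lemma bounded_relators_16: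
  assumes n: "n \<ge> 10" and rel: "relators5 G \<rho> n \<subseteq> {\<one>} \<or> relators6 G \<rho> n \<subseteq> {\<one>} \<or>
    relators7 G \<rho> n \<subseteq> {\<one>} \<or> relators8 G \<rho> n \<subseteq> {\<one>}"
  shows "bounded_rank_3 G \<rho> (n - 5) 5"
proof -
  have base: "relators_base G \<rho> (2 ^ (n - 5)) \<subseteq> {\<one>}"
    using rel by (auto simp: relators5_def relators6_def relators7_def relators8_def)
  interpret involution_triple G "\<rho> 0" "\<rho> 1" "\<rho> 2" by (rule relators_base_triple[OF base])
  have pow: "(\<rho> 1 \<otimes> \<rho> 2) [^] (2 ^ m :: nat) = rot (2 ^ m)" for m
    using bc_pow[of "2 ^ m"] by simp
  have pow2: "(\<rho> 1 \<otimes> \<rho> 2) [^] (2::nat) = rot 2" "(\<rho> 1 \<otimes> \<rho> 2) [^] (4::nat) = rot 4"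
    using bc_pow[of 2] bc_pow[of 4] by simp_all
  have one: "rot (2 ^ (n - 5)) = \<one>"
    using base by (simp add: relators_base_def pow del: One_nat_def)
  let ?X = "commutator G (\<rho> 0) (rot 2)" and ?Y = "commutator G (\<rho> 0) (rot 4)"
  have sq: "?X [^] (2::nat) = ?X \<otimes> ?X"
    by (rule pow_2) (use closed in \<open>simp del: One_nat_def\<close>)
  have "?X \<otimes> ?X = rot 0 \<or> ?X \<otimes> ?X \<otimes> rot (2 ^ (n - 6)) = rot 0"
    using rel by (auto simp: relators5_def relators6_def relators7_def relators8_def pow pow2 sq
        simp del: One_nat_def)
  then obtain k where k: "?X \<otimes> ?X = rot k" by (auto simp: rot_right_cancel simp del: One_nat_def rot_0)
  have "?Y = rot 0 \<or> ?Y \<otimes> rot (2 ^ (n - 6)) = rot 0"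
    using rel by (auto simp: relators5_def relators6_def relators7_def relators8_def pow pow2
        simp del: One_nat_def)
  then have "?Y = rot 0 \<or> ?Y = rot (- (2 ^ (n - 6)))"
    by (auto simp: rot_right_cancel simp del: One_nat_def rot_0)
  moreover have "4 dvd (2::int) ^ (n - 6)"
    using le_imp_power_dvd[of 2 "n - 6" "2::int"] n by simp
  ultimately obtain l where l: "?Y = rot l" "4 dvd l"
    by (metis dvd_0_right dvd_minus_iff)
  have "finite (carrier G) \<and> order G \<le> 2 ^ (m + 5)" if "rot (2 ^ m) = \<one>" for m
    using card_le_of_commutator_a_rot[OF k l] card_D_le_pow(1)[OF that]
      order_le_mult_D[OF that, of 4] by simp
  then show ?thesis
    using one involution_triple_axioms
    by (simp add: bounded_rank_3_def pow del: One_nat_def)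
qed

end

end

lemma presented_relators_trivial:
  fixes R :: "(nat \<times> bool) list set"
  assumes R: "R \<subseteq> carrier F3"
    and rel: "\<And>\<pi>. group_hom F3 (presented_group {0, 1, 2} R) \<pi> \<Longrightarrow>
      (\<And>x. x \<in> {0, 1, 2} \<Longrightarrow> \<pi> (free_gen x) = presented_gen {0, 1, 2} R x) \<Longrightarrow> \<pi> ` R = R'"
  shows "R' \<subseteq> {\<one>\<^bsub>presented_group {0, 1, 2} R\<^esub>}"
proof -
  let ?\<pi> = "\<lambda>w. normal_closure F3 R #>\<^bsub>F3\<^esub> w"
  have "group_hom F3 (presented_group {0, 1, 2} R) ?\<pi>"
    using group_free_group group_presented_group[OF R] presented_hom[OF R]
    by (simp add: group_hom_def group_hom_axioms_def)
  from rel[OF this] have "?\<pi> ` R = R'" by (simp add: presented_gen_def)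
  then show ?thesis using presented_relator[OF R] by auto
qed

text \<open>\<open>R'\<close> is the set of relators evaluated in \<open>G\<close>. Describing it
  through every \<open>h\<close> that respects the generators allows \<open>h\<close> to come from a
  given isomorphism in one direction and from the evaluation of words in the other.\<close>

lemma iso_presentation_iff:
  fixes R :: "(nat \<times> bool) list set"
  assumes G: "group G" "\<rho> ` {0, 1, 2} \<subseteq> carrier G" "generate G (\<rho> ` {0, 1, 2}) = carrier G"
    and R: "R \<subseteq> carrier F3"
    and R': "\<And>h. group_hom F3 G h \<Longrightarrow> (\<And>x. x \<in> {0, 1, 2} \<Longrightarrow> h (free_gen x) = \<rho> x) \<Longrightarrow> h ` R = R'"
    and P: "bounded_rank_3 (presented_group {0, 1, 2} R) (presented_gen {0, 1, 2} R) s i"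
    and ord: "order G = 2 ^ (s + i)"
  shows "iso_presentation G \<rho> {0, 1, 2} R \<longleftrightarrow> R' \<subseteq> {\<one>\<^bsub>G\<^esub>}"
proof
  have hom: "group_hom F3 G h" if "h \<in> hom F3 G" for h
    using that group_free_group G(1) by (simp add: group_hom_def group_hom_axioms_def)
  show "R' \<subseteq> {\<one>\<^bsub>G\<^esub>}" if "iso_presentation G \<rho> {0, 1, 2} R"
  proof (rule iso_presentationD[OF G(1,2) R that])
    fix h assume h: "h \<in> hom F3 G" "\<And>x. x \<in> {0, 1, 2} \<Longrightarrow> h (free_gen x) = \<rho> x"
      "\<And>r. r \<in> R \<Longrightarrow> h r = \<one>\<^bsub>G\<^esub>"
    then show ?thesis using R'[OF hom[OF h(1)] h(2)] by auto
  qed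
  interpret G: group G by (rule G)
  let ?h = "word_eval G \<rho>"
  have h: "?h \<in> hom F3 G" by (rule G.word_eval_hom[OF G(2)])
  have h_gen: "?h (free_gen x) = \<rho> x" if "x \<in> {0, 1, 2}" for x
    by (rule G.word_eval_free_gen[OF G(2) that])
  show "iso_presentation G \<rho> {0, 1, 2} R" if triv: "R' \<subseteq> {\<one>\<^bsub>G\<^esub>}"
  proof (rule iso_presentationI[OF G _ R h h_gen])
    show "finite (carrier G)" using ord G.order_gt_0_iff_finite by simp
    show "?h r = \<one>\<^bsub>G\<^esub>" if "r \<in> R" for r
      using that triv R'[OF hom[OF h] h_gen] by blast
    show "finite (carrier (presented_group {0, 1, 2} R))"
      "order (presented_group {0, 1, 2} R) \<le> order G"
      using P ord by (auto simp: bounded_rank_3_def)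
  qed
qed

text \<open>In an entry \<open>(R, s, i)\<close>, \<open>2 ^ s\<close> is the exponent that
  \<open>R\<close> prescribes for \<open>b c\<close>, and \<open>2 ^ i\<close> bounds the index of
  the powers of \<open>b c\<close>; for \<open>n \<ge> 10\<close> always
  \<open>s + i = n\<close>.\<close>

definition relator_table :: "nat \<Rightarrow> ((nat \<times> bool) list set \<times> nat \<times> nat) set" where
  "relator_table n = {(relators1 F3 free_gen n, n - 3, 3), (relators2 F3 free_gen n, n - 3, 3),
     (relators3 F3 free_gen n, n - 4, 4), (relators4 F3 free_gen n, n - 4, 4),
     (relators5 F3 free_gen n, n - 5, 5), (relators6 F3 free_gen n, n - 5, 5),
     (relators7 F3 free_gen n, n - 5, 5), (relators8 F3 free_gen n, n - 5, 5)}"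

lemma bounded_presented_relators:
  assumes n: "n \<ge> 10" and R: "(R, s, i) \<in> relator_table n"
  shows "R \<subseteq> carrier F3"
    and "bounded_rank_3 (presented_group {0, 1, 2} R) (presented_gen {0, 1, 2} R) s i"
proof -
  have "free_gen 0 \<in> carrier F3" "free_gen 1 \<in> carrier F3" "free_gen 2 \<in> carrier F3"
    by (simp_all add: free_gen_closed)
  note cl = this
  show R_closed: "R \<subseteq> carrier F3"
    using R group.relators_closed[OF group_free_group cl] unfolding relator_table_def by blast
  let ?P = "presented_group {0, 1, 2} R" and ?g = "presented_gen {0, 1, 2} R"
  interpret P: group ?P by (rule group_presented_group[OF R_closed])
  have gen: "generate ?P (?g ` {0, 1, 2}) = carrier ?P"
    by (rule generate_presented_gen[OF R_closed])
  then have gcl: "?g ` {0, 1, 2} \<subseteq> carrier ?P"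
    using generate.incl by (metis subsetI)
  note triv = presented_relators_trivial[OF R_closed]
  note img = group_hom.image_relators[OF _ cl, where \<sigma> = ?g and n = n]
  consider "R = relators1 F3 free_gen n" "s = n - 3" "i = 3"
    | "R = relators2 F3 free_gen n" "s = n - 3" "i = 3"
    | "R = relators3 F3 free_gen n" "s = n - 4" "i = 4"
    | "R = relators4 F3 free_gen n" "s = n - 4" "i = 4"
    | "R = relators5 F3 free_gen n" "s = n - 5" "i = 5"
    | "R = relators6 F3 free_gen n" "s = n - 5" "i = 5"
    | "R = relators7 F3 free_gen n" "s = n - 5" "i = 5"
    | "R = relators8 F3 free_gen n" "s = n - 5" "i = 5"
    using R unfolding relator_table_def insert_iff prod.inject empty_iff
    by (elim disjE conjE FalseE) (rule that, assumption+)+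
  then show "bounded_rank_3 ?P ?g s i"
  proof cases
    case 1
    have "relators1 ?P ?g n \<subseteq> {\<one>\<^bsub>?P\<^esub>}" by (rule triv, rule img(1)[folded 1(1)]) simp_all
    then show ?thesis unfolding 1(2,3) using P.bounded_relators_4[OF gcl gen] by blast
  next
    case 2
    have "relators2 ?P ?g n \<subseteq> {\<one>\<^bsub>?P\<^esub>}" by (rule triv, rule img(2)[folded 2(1)]) simp_all
    then show ?thesis unfolding 2(2,3) using P.bounded_relators_4[OF gcl gen] by blast
  next
    case 3
    have "relators3 ?P ?g n \<subseteq> {\<one>\<^bsub>?P\<^esub>}" by (rule triv, rule img(3)[folded 3(1)]) simp_all
    then show ?thesis unfolding 3(2,3) using P.bounded_relators_8[OF gcl gen n] by blast
  next
    case 4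
    have "relators4 ?P ?g n \<subseteq> {\<one>\<^bsub>?P\<^esub>}" by (rule triv, rule img(4)[folded 4(1)]) simp_all
    then show ?thesis unfolding 4(2,3) using P.bounded_relators_8[OF gcl gen n] by blast
  next
    case 5
    have "relators5 ?P ?g n \<subseteq> {\<one>\<^bsub>?P\<^esub>}" by (rule triv, rule img(5)[folded 5(1)]) simp_all
    then show ?thesis unfolding 5(2,3) using P.bounded_relators_16[OF gcl gen n] by blast
  next
    case 6
    have "relators6 ?P ?g n \<subseteq> {\<one>\<^bsub>?P\<^esub>}" by (rule triv, rule img(6)[folded 6(1)]) simp_all
    then show ?thesis unfolding 6(2,3) using P.bounded_relators_16[OF gcl gen n] by blast
  next
    case 7
    have "relators7 ?P ?g n \<subseteq> {\<one>\<^bsub>?P\<^esub>}" by (rule triv, rule img(7)[folded 7(1)]) simp_all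
    then show ?thesis unfolding 7(2,3) using P.bounded_relators_16[OF gcl gen n] by blast
  next
    case 8
    have "relators8 ?P ?g n \<subseteq> {\<one>\<^bsub>?P\<^esub>}" by (rule triv, rule img(8)[folded 8(1)]) simp_all
    then show ?thesis unfolding 8(2,3) using P.bounded_relators_16[OF gcl gen n] by blast
  qed
qed

lemma iso_presentation_relators_iff:
  assumes n: "n \<ge> 10" and ord: "order G = 2 ^ n"
    and G: "group G" "\<rho> ` {0, 1, 2} \<subseteq> carrier G" "generate G (\<rho> ` {0, 1, 2}) = carrier G"
  shows "iso_presentation G \<rho> {0, 1, 2} (relators1 F3 free_gen n) \<longleftrightarrow> relators1 G \<rho> n \<subseteq> {\<one>\<^bsub>G\<^esub>}"
    "iso_presentation G \<rho> {0, 1, 2} (relators2 F3 free_gen n) \<longleftrightarrow> relators2 G \<rho> n \<subseteq> {\<one>\<^bsub>G\<^esub>}"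
    "iso_presentation G \<rho> {0, 1, 2} (relators3 F3 free_gen n) \<longleftrightarrow> relators3 G \<rho> n \<subseteq> {\<one>\<^bsub>G\<^esub>}"
    "iso_presentation G \<rho> {0, 1, 2} (relators4 F3 free_gen n) \<longleftrightarrow> relators4 G \<rho> n \<subseteq> {\<one>\<^bsub>G\<^esub>}"
    "iso_presentation G \<rho> {0, 1, 2} (relators5 F3 free_gen n) \<longleftrightarrow> relators5 G \<rho> n \<subseteq> {\<one>\<^bsub>G\<^esub>}"
    "iso_presentation G \<rho> {0, 1, 2} (relators6 F3 free_gen n) \<longleftrightarrow> relators6 G \<rho> n \<subseteq> {\<one>\<^bsub>G\<^esub>}"
    "iso_presentation G \<rho> {0, 1, 2} (relators7 F3 free_gen n) \<longleftrightarrow> relators7 G \<rho> n \<subseteq> {\<one>\<^bsub>G\<^esub>}"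
    "iso_presentation G \<rho> {0, 1, 2} (relators8 F3 free_gen n) \<longleftrightarrow> relators8 G \<rho> n \<subseteq> {\<one>\<^bsub>G\<^esub>}"
proof -
  have cl: "free_gen 0 \<in> carrier F3" "free_gen 1 \<in> carrier F3" "free_gen 2 \<in> carrier F3"
    by (simp_all add: free_gen_closed)
  note img = group_hom.image_relators[OF _ cl, where \<sigma> = \<rho>]
  have iff: "iso_presentation G \<rho> {0, 1, 2} R \<longleftrightarrow> R' \<subseteq> {\<one>\<^bsub>G\<^esub>}"
    if R: "(R, s, i) \<in> relator_table n"
      and R': "\<And>h. group_hom F3 G h \<Longrightarrow> (\<And>x. x \<in> {0, 1, 2} \<Longrightarrow> h (free_gen x) = \<rho> x) \<Longrightarrow> h ` R = R'"
    for R s i R'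
  proof (rule iso_presentation_iff[OF G bounded_presented_relators(1)[OF n R] R'
        bounded_presented_relators(2)[OF n R]])
    show "order G = 2 ^ (s + i)" using R ord n by (auto simp: relator_table_def)
  qed
  show "iso_presentation G \<rho> {0, 1, 2} (relators1 F3 free_gen n) \<longleftrightarrow> relators1 G \<rho> n \<subseteq> {\<one>\<^bsub>G\<^esub>}"
    by (rule iff[of _ "n - 3" 3], simp add: relator_table_def, rule img(1)) simp_all
  show "iso_presentation G \<rho> {0, 1, 2} (relators2 F3 free_gen n) \<longleftrightarrow> relators2 G \<rho> n \<subseteq> {\<one>\<^bsub>G\<^esub>}"
    by (rule iff[of _ "n - 3" 3], simp add: relator_table_def, rule img(2)) simp_all
  show "iso_presentation G \<rho> {0, 1, 2} (relators3 F3 free_gen n) \<longleftrightarrow> relators3 G \<rho> n \<subseteq> {\<one>\<^bsub>G\<^esub>}"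
    by (rule iff[of _ "n - 4" 4], simp add: relator_table_def, rule img(3)) simp_all
  show "iso_presentation G \<rho> {0, 1, 2} (relators4 F3 free_gen n) \<longleftrightarrow> relators4 G \<rho> n \<subseteq> {\<one>\<^bsub>G\<^esub>}"
    by (rule iff[of _ "n - 4" 4], simp add: relator_table_def, rule img(4)) simp_all
  show "iso_presentation G \<rho> {0, 1, 2} (relators5 F3 free_gen n) \<longleftrightarrow> relators5 G \<rho> n \<subseteq> {\<one>\<^bsub>G\<^esub>}"
    by (rule iff[of _ "n - 5" 5], simp add: relator_table_def, rule img(5)) simp_all
  show "iso_presentation G \<rho> {0, 1, 2} (relators6 F3 free_gen n) \<longleftrightarrow> relators6 G \<rho> n \<subseteq> {\<one>\<^bsub>G\<^esub>}"
    by (rule iff[of _ "n - 5" 5], simp add: relator_table_def, rule img(6)) simp_all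
  show "iso_presentation G \<rho> {0, 1, 2} (relators7 F3 free_gen n) \<longleftrightarrow> relators7 G \<rho> n \<subseteq> {\<one>\<^bsub>G\<^esub>}"
    by (rule iff[of _ "n - 5" 5], simp add: relator_table_def, rule img(7)) simp_all
  show "iso_presentation G \<rho> {0, 1, 2} (relators8 F3 free_gen n) \<longleftrightarrow> relators8 G \<rho> n \<subseteq> {\<one>\<^bsub>G\<^esub>}"
    by (rule iff[of _ "n - 5" 5], simp add: relator_table_def, rule img(8)) simp_all
qed

text \<open>In each case the relevant elements are trivial or equal to the involution among the
  powers of \<open>r\<close>, which is its own inverse and can therefore be moved to the other side.
  One such choice gives two sets of relators, and the two independent choices of the third case give
  four.\<close>

lemma relators_of_type:
  assumes n: "n \<ge> 10" and C: "string_C_group3 G \<rho>" and ord: "order G = 2 ^ n"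
  shows "schlafli_type G \<rho> = (4, 2 ^ (n - 3)) \<Longrightarrow>
      relators1 G \<rho> n \<subseteq> {\<one>\<^bsub>G\<^esub>} \<or> relators2 G \<rho> n \<subseteq> {\<one>\<^bsub>G\<^esub>}"
    and "schlafli_type G \<rho> = (4, 2 ^ (n - 4)) \<Longrightarrow>
      relators3 G \<rho> n \<subseteq> {\<one>\<^bsub>G\<^esub>} \<or> relators4 G \<rho> n \<subseteq> {\<one>\<^bsub>G\<^esub>}"
    and "schlafli_type G \<rho> = (4, 2 ^ (n - 5)) \<Longrightarrow>
      relators5 G \<rho> n \<subseteq> {\<one>\<^bsub>G\<^esub>} \<or> relators6 G \<rho> n \<subseteq> {\<one>\<^bsub>G\<^esub>} \<or>
      relators7 G \<rho> n \<subseteq> {\<one>\<^bsub>G\<^esub>} \<or> relators8 G \<rho> n \<subseteq> {\<one>\<^bsub>G\<^esub>}"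
proof -
  interpret group G using C by (simp add: string_C_group3_def)
  have closed: "\<rho> 0 \<in> carrier G" "\<rho> 1 \<in> carrier G" "\<rho> 2 \<in> carrier G"
    and ords: "group.ord G (\<rho> 0) = 2" "group.ord G (\<rho> 1) = 2" "group.ord G (\<rho> 2) = 2"
    and comm: "\<rho> 0 \<otimes>\<^bsub>G\<^esub> \<rho> 2 = \<rho> 2 \<otimes>\<^bsub>G\<^esub> \<rho> 0"
    and gen: "generate G {\<rho> 0, \<rho> 1, \<rho> 2} = carrier G"
    using C by (simp_all add: string_C_group3_def del: One_nat_def)
  note sq = pow_ord_eq_1[of "\<rho> 0", unfolded ords] pow_ord_eq_1[of "\<rho> 1", unfolded ords]
    pow_ord_eq_1[of "\<rho> 2", unfolded ords]
  have ac: "(\<rho> 0 \<otimes>\<^bsub>G\<^esub> \<rho> 2) [^]\<^bsub>G\<^esub> (2::nat) = \<one>\<^bsub>G\<^esub>"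
    using pow_mult_distrib[OF comm closed(1,3), of 2] sq closed by simp
  have triple: "involution_triple_2 G (\<rho> 0) (\<rho> 1) (\<rho> 2) p" and base: "relators_base G \<rho> (2 ^ p) \<subseteq> {\<one>\<^bsub>G\<^esub>}"
    if t: "schlafli_type G \<rho> = (4, 2 ^ p)" for p
  proof -
    have ab: "(\<rho> 0 \<otimes>\<^bsub>G\<^esub> \<rho> 1) [^]\<^bsub>G\<^esub> (4::nat) = \<one>\<^bsub>G\<^esub>" and bc: "group.ord G (\<rho> 1 \<otimes>\<^bsub>G\<^esub> \<rho> 2) = 2 ^ p"
      using t closed pow_ord_eq_1[of "\<rho> 0 \<otimes>\<^bsub>G\<^esub> \<rho> 1"] by (simp_all add: schlafli_type_def del: One_nat_def)
    interpret involution_triple G "\<rho> 0" "\<rho> 1" "\<rho> 2"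
      by (rule involution_tripleI) (use closed sq ab ac gen in simp_all)
    show "involution_triple_2 G (\<rho> 0) (\<rho> 1) (\<rho> 2) p"
      by unfold_locales (use int_pow_eq_id[of "\<rho> 1 \<otimes>\<^bsub>G\<^esub> \<rho> 2"] bc closed in \<open>simp add: rot_def del: One_nat_def\<close>)
    show "relators_base G \<rho> (2 ^ p) \<subseteq> {\<one>\<^bsub>G\<^esub>}"
      using closed sq ab ac bc pow_ord_eq_1[of "\<rho> 1 \<otimes>\<^bsub>G\<^esub> \<rho> 2"]
      by (simp add: relators_base_def del: One_nat_def)
  qed
  show "relators1 G \<rho> n \<subseteq> {\<one>\<^bsub>G\<^esub>} \<or> relators2 G \<rho> n \<subseteq> {\<one>\<^bsub>G\<^esub>}"
    if t: "schlafli_type G \<rho> = (4, 2 ^ (n - 3))"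
  proof -
    interpret involution_triple_2 G "\<rho> 0" "\<rho> 1" "\<rho> 2" "n - 3" by (rule triple[OF t])
    have n4: "n - 3 - 1 = n - 4" by simp
    have "n - 3 = Suc (n - 4)" using n by simp
    then have half: "rot (2 ^ (n - 4)) \<otimes>\<^bsub>G\<^esub> rot (2 ^ (n - 4)) = \<one>\<^bsub>G\<^esub>"
      by (simp add: rot_add rot_eq_one del: One_nat_def flip: mult_2)
    have "commutator G z (\<rho> 2) = \<one>\<^bsub>G\<^esub> \<or> commutator G z (\<rho> 2) = rot (2 ^ (n - 4))"
      using commutator_of_index_4 n ord n4 by simp
    then show ?thesis
      using base[OF t] half bc_pow[of "2 ^ (n - 4)"]
      by (auto simp: relators1_def relators2_def ab_squared simp del: One_nat_def)
  qed
  show "relators3 G \<rho> n \<subseteq> {\<one>\<^bsub>G\<^esub>} \<or> relators4 G \<rho> n \<subseteq> {\<one>\<^bsub>G\<^esub>}"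
    if t: "schlafli_type G \<rho> = (4, 2 ^ (n - 4))"
  proof -
    interpret involution_triple_2 G "\<rho> 0" "\<rho> 1" "\<rho> 2" "n - 4" by (rule triple[OF t])
    have n4: "n - 4 - 1 = n - 5" by simp
    have "n - 4 = Suc (n - 5)" using n by simp
    then have half: "rot (2 ^ (n - 5)) \<otimes>\<^bsub>G\<^esub> rot (2 ^ (n - 5)) = \<one>\<^bsub>G\<^esub>"
      by (simp add: rot_add rot_eq_one del: One_nat_def flip: mult_2)
    have "commutator G z (rot 2) = \<one>\<^bsub>G\<^esub> \<or> commutator G z (rot 2) = rot (2 ^ (n - 5))"
      using commutator_of_index_8 n ord n4 by simp
    then show ?thesis
      using base[OF t] half bc_pow[of "2 ^ (n - 5)"] bc_pow[of 2]
      by (auto simp: relators3_def relators4_def ab_squared simp del: One_nat_def)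
  qed
  show "relators5 G \<rho> n \<subseteq> {\<one>\<^bsub>G\<^esub>} \<or> relators6 G \<rho> n \<subseteq> {\<one>\<^bsub>G\<^esub>} \<or>
      relators7 G \<rho> n \<subseteq> {\<one>\<^bsub>G\<^esub>} \<or> relators8 G \<rho> n \<subseteq> {\<one>\<^bsub>G\<^esub>}"
    if t: "schlafli_type G \<rho> = (4, 2 ^ (n - 5))"
  proof -
    interpret involution_triple_2 G "\<rho> 0" "\<rho> 1" "\<rho> 2" "n - 5" by (rule triple[OF t])
    have n4: "n - 5 - 1 = n - 6" by simp
    have "n - 5 = Suc (n - 6)" using n by simp
    then have half: "rot (2 ^ (n - 6)) \<otimes>\<^bsub>G\<^esub> rot (2 ^ (n - 6)) = \<one>\<^bsub>G\<^esub>"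
      by (simp add: rot_add rot_eq_one del: One_nat_def flip: mult_2)
    let ?X = "commutator G (\<rho> 0) (rot 2)" and ?Y = "commutator G (\<rho> 0) (rot 4)"
    have sq: "?X [^]\<^bsub>G\<^esub> (2::nat) = ?X \<otimes>\<^bsub>G\<^esub> ?X"
      by (rule pow_2) (use closed in \<open>simp del: One_nat_def\<close>)
    have "\<exists>k l. ?X \<otimes>\<^bsub>G\<^esub> ?X = rot k \<and> ?Y = rot l \<and> 2 ^ (n - 5) dvd 2 * k \<and> 2 ^ (n - 5) dvd 2 * l"
      by (rule commutator_of_index_16) (use n ord in simp_all)
    then obtain k l where kl: "?X \<otimes>\<^bsub>G\<^esub> ?X = rot k" "?Y = rot l"
      "2 ^ (n - 5) dvd 2 * k" "2 ^ (n - 5) dvd 2 * l"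
      by blast
    have "?X \<otimes>\<^bsub>G\<^esub> ?X = \<one>\<^bsub>G\<^esub> \<or> ?X \<otimes>\<^bsub>G\<^esub> ?X = rot (2 ^ (n - 6))"
      unfolding kl(1) using rot_eq_one_or_half[OF kl(3)] n n4 by simp
    moreover have "?Y = \<one>\<^bsub>G\<^esub> \<or> ?Y = rot (2 ^ (n - 6))"
      unfolding kl(2) using rot_eq_one_or_half[OF kl(4)] n n4 by simp
    ultimately show ?thesis
      using base[OF t] half bc_pow[of "2 ^ (n - 6)"] bc_pow[of 2] bc_pow[of 4]
      by (auto simp: relators5_def relators6_def relators7_def relators8_def sq
          simp del: One_nat_def)
  qed
qed

theorem theorem1p2:
  fixes G :: "('a, 'b) monoid_scheme" and \<rho> :: "nat \<Rightarrow> 'a" and n :: nat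
  assumes "n \<ge> 10"
    and "string_C_group3 G \<rho>"
    and "order G = 2 ^ n"
  shows "(schlafli_type G \<rho> = (4, 2 ^ (n - 3)) \<longleftrightarrow>
            iso_presentation G \<rho> {0,1,2} (relators1 F3 free_gen n) \<or>
            iso_presentation G \<rho> {0,1,2} (relators2 F3 free_gen n))
       \<and> (schlafli_type G \<rho> = (4, 2 ^ (n - 4)) \<longleftrightarrow>
            iso_presentation G \<rho> {0,1,2} (relators3 F3 free_gen n) \<or>
            iso_presentation G \<rho> {0,1,2} (relators4 F3 free_gen n))
       \<and> (schlafli_type G \<rho> = (4, 2 ^ (n - 5)) \<longleftrightarrow>
            iso_presentation G \<rho> {0,1,2} (relators5 F3 free_gen n) \<or>
            iso_presentation G \<rho> {0,1,2} (relators6 F3 free_gen n) \<or>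
            iso_presentation G \<rho> {0,1,2} (relators7 F3 free_gen n) \<or>
            iso_presentation G \<rho> {0,1,2} (relators8 F3 free_gen n))"
proof -
  have G: "group G" "\<rho> ` {0, 1, 2} \<subseteq> carrier G" "generate G (\<rho> ` {0, 1, 2}) = carrier G"
    using assms(2) by (auto simp: string_C_group3_def)
  interpret group G by (rule G)
  have type: "schlafli_type G \<rho> = (4, 2 ^ (n - i))"
    if "bounded_rank_3 G \<rho> (n - i) i" "i \<in> {3, 4, 5}" for i
    using that assms(1,3) by (intro schlafli_type_of_bounded_rank_3) auto
  note iso = iso_presentation_relators_iff[OF assms(1,3) G]
  show ?thesis
    unfolding iso
  proof (intro conjI iffI)
    show "schlafli_type G \<rho> = (4, 2 ^ (n - 3))"
      if "relators1 G \<rho> n \<subseteq> {\<one>\<^bsub>G\<^esub>} \<or> relators2 G \<rho> n \<subseteq> {\<one>\<^bsub>G\<^esub>}"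
      by (rule type[OF bounded_relators_4[OF G(2,3) that]]) simp
    show "schlafli_type G \<rho> = (4, 2 ^ (n - 4))"
      if "relators3 G \<rho> n \<subseteq> {\<one>\<^bsub>G\<^esub>} \<or> relators4 G \<rho> n \<subseteq> {\<one>\<^bsub>G\<^esub>}"
      by (rule type[OF bounded_relators_8[OF G(2,3) assms(1) that]]) simp
    show "schlafli_type G \<rho> = (4, 2 ^ (n - 5))"
      if "relators5 G \<rho> n \<subseteq> {\<one>\<^bsub>G\<^esub>} \<or> relators6 G \<rho> n \<subseteq> {\<one>\<^bsub>G\<^esub>} \<or>
        relators7 G \<rho> n \<subseteq> {\<one>\<^bsub>G\<^esub>} \<or> relators8 G \<rho> n \<subseteq> {\<one>\<^bsub>G\<^esub>}"
      by (rule type[OF bounded_relators_16[OF G(2,3) assms(1) that]]) simp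
  qed (rule relators_of_type[OF assms], assumption)+
qed

end
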